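(* Let $F$ be Thompson's group. Neither the reduced group $C^*$-algebra $C_r^*(F)$ nor the full group $C^*$-algebra $C^*(F)$ is residually finite dimensional.
   Context: $F$ denotes Thompson's group: the (countable, discrete) group, under composition, of all piecewise linear homeomorphisms $f:[0,1]\to[0,1]$ that are differentiable except at finitely many dyadic rationals and such that on intervals of differentiability the derivatives are (integer) powers of $2$. $C_r^*(F)$ is the norm closure in $B(\ell^2(F))$ of the linear span of the left translation unitaries $L_g$, $g\in F$, where $L_g\psi(h)=\psi(g^{-1}h)$. $C^*(F)$ is the full (universal) group $C^*$-algebra of $F$. A separable $C^*$-algebra $R$ is called residually finite dimensional (RFD) if for each non-zero $x\in R$ there exists a $*$-homomorphism $\pi:R\to B$ into a $C^*$-algebra $B$ with $\dim(B)<\infty$ and $\pi(x)\neq 0$. Equivalently, $R$ embeds in a $C^*$-algebra of the form $\prod_{n=1}^\infty M_{k(n)}(\mathbb{C})$. *)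

theory Defs
  imports "HOL-Analysis.Analysis" "HOL-Algebra.Module"
begin

section \<open>Thompson's group\<close>

definition dyadic_rationals :: "real set" where
  "dyadic_rationals = {of_int m / 2 ^ n | (m :: int) (n :: nat). True}"

definition piecewise_linear_on_unit :: "(real \<Rightarrow> real) \<Rightarrow> bool" where
  "piecewise_linear_on_unit f \<longleftrightarrow>
     (\<exists>P. finite P \<and>
        (\<forall>a b. 0 \<le> a \<and> a < b \<and> b \<le> 1 \<and> {a<..<b} \<inter> P = {} \<longrightarrow>
           (\<exists>m c. \<forall>x\<in>{a..b}. f x = m * x + c)))"

text \<open>Differentiability at the endpoints of the unit interval is one-sided. Maps of the unit interval
  are represented by functions that are \<^term>\<open>undefined\<close> outside of it, so that equality is
  pointwise equality on the unit interval.\<close>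

definition thompson_map :: "(real \<Rightarrow> real) \<Rightarrow> bool" where
  "thompson_map f \<longleftrightarrow>
     f \<in> extensional {0..1} \<and>
     (\<exists>g. homeomorphism {0..1} {0..1} f g) \<and>
     piecewise_linear_on_unit f \<and>
     (\<exists>D. finite D \<and> D \<subseteq> dyadic_rationals \<and>
        (\<forall>x\<in>{0..1} - D. f differentiable (at x within {0..1}))) \<and>
     (\<forall>x\<in>{0..1}. \<forall>d. (f has_real_derivative d) (at x within {0..1}) \<longrightarrow>
        (\<exists>k::int. d = 2 powi k))"

lemma thompson_map_id: "thompson_map (\<lambda>x\<in>{0..1}. x)"
proof -
  let ?i = "\<lambda>x\<in>{0..1::real}. x"
  have d1: "(?i has_real_derivative 1) (at x within {0..1})" if "x \<in> {0..1}" for x :: real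
  proof (rule has_field_derivative_transform_within[OF _ zero_less_one that])
    show "((\<lambda>x. x) has_real_derivative 1) (at x within {0..1})" by (rule DERIV_ident)
  qed simp
  have d2: "d = 1" if "x \<in> {0..1}" "(?i has_real_derivative d) (at x within {0..1})" for x d :: real
  proof -
    have "at x within {0..1} \<noteq> bot"
      using that(1) by (simp add: trivial_limit_within islimpt_Icc)
    then show ?thesis
      using that(2) d1[OF that(1)] unfolding has_field_derivative_iff by (rule tendsto_unique)
  qed
  have "homeomorphism {0..1} {0..1} ?i (\<lambda>x. x)"
    by (rule homeomorphism_cong[OF homeomorphism_ident]) auto
  then have 1: "\<exists>g. homeomorphism {0..1} {0..1} ?i g" by blast
  have "\<forall>x\<in>{a..b}. ?i x = 1 * x + 0" if "0 \<le> a" "b \<le> 1" for a b :: real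
    using that by simp
  then have 2: "piecewise_linear_on_unit ?i"
    unfolding piecewise_linear_on_unit_def by (meson finite.emptyI)
  have "\<forall>x\<in>{0..1} - {}. ?i differentiable (at x within {0..1})"
    using d1 real_differentiable_def by blast
  then have 3: "\<exists>D. finite D \<and> D \<subseteq> dyadic_rationals \<and>
      (\<forall>x\<in>{0..1} - D. ?i differentiable (at x within {0..1}))"
    by (meson empty_subsetI finite.emptyI)
  have "(1 :: real) = 2 powi 0" by simp
  then have 4: "\<forall>x\<in>{0..1}. \<forall>d. (?i has_real_derivative d) (at x within {0..1}) \<longrightarrow>
      (\<exists>k::int. d = 2 powi k)"
    using d2 by metis
  show ?thesis
    unfolding thompson_map_def using 1 2 3 4 restrict_extensional by blast
qed

typedef thompson = "{f. thompson_map f}"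
  using thompson_map_id by blast

definition thompson_group :: "thompson monoid" where
  "thompson_group =
     \<lparr>carrier = UNIV,
      mult = (\<lambda>f g. Abs_thompson (compose {0..1} (Rep_thompson f) (Rep_thompson g))),
      one = Abs_thompson (\<lambda>x\<in>{0..1}. x)\<rparr>"


section \<open>The Hilbert space of square summable functions and its operators\<close>

typedef 'a ell2 = "{f :: 'a \<Rightarrow> complex. (\<lambda>x. (cmod (f x))\<^sup>2) summable_on UNIV}"
  by (rule exI[of _ "\<lambda>_. 0"]) simp

setup_lifting type_definition_ell2

lemma ell2_add_summable:
  fixes f g :: "'a \<Rightarrow> complex"
  assumes "(\<lambda>x. (cmod (f x))\<^sup>2) summable_on UNIV" "(\<lambda>x. (cmod (g x))\<^sup>2) summable_on UNIV"
  shows "(\<lambda>x. (cmod (f x + g x))\<^sup>2) summable_on UNIV"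
proof (rule summable_on_comparison_test)
  show "(\<lambda>x. 2 * (cmod (f x))\<^sup>2 + 2 * (cmod (g x))\<^sup>2) summable_on UNIV"
    by (intro summable_on_add summable_on_cmult_right assms)
  fix x
  have "(cmod (f x + g x))\<^sup>2 \<le> (cmod (f x) + cmod (g x))\<^sup>2"
    by (intro power_mono norm_triangle_ineq) auto
  also have "\<dots> \<le> 2 * (cmod (f x))\<^sup>2 + 2 * (cmod (g x))\<^sup>2"
    using sum_squares_bound[of "cmod (f x)" "cmod (g x)"] by (simp add: power2_sum)
  finally show "(cmod (f x + g x))\<^sup>2 \<le> 2 * (cmod (f x))\<^sup>2 + 2 * (cmod (g x))\<^sup>2" .
qed auto

lemma ell2_scale_summable:
  fixes f :: "'a \<Rightarrow> complex"
  assumes "(\<lambda>x. (cmod (f x))\<^sup>2) summable_on UNIV"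
  shows "(\<lambda>x. (cmod (c * f x))\<^sup>2) summable_on UNIV"
  using summable_on_cmult_right[OF assms, of "(cmod c)\<^sup>2"]
  by (simp add: norm_mult power_mult_distrib)

lemma ell2_inner_summable:
  fixes f g :: "'a \<Rightarrow> complex"
  assumes "(\<lambda>x. (cmod (f x))\<^sup>2) summable_on UNIV" "(\<lambda>x. (cmod (g x))\<^sup>2) summable_on UNIV"
  shows "(\<lambda>x. inner (f x) (g x)) summable_on UNIV"
proof -
  have "(\<lambda>x. inner (f x) (g x)) = (\<lambda>x. ((cmod (f x + g x))\<^sup>2 + - 1 * (cmod (f x))\<^sup>2 + - 1 * (cmod (g x))\<^sup>2) * (1/2))"
    by (auto simp: power2_norm_eq_inner inner_add_left inner_add_right inner_commute)
  then show ?thesis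
    by (simp only:) (intro summable_on_cmult_left summable_on_add ell2_add_summable summable_on_cmult_right assms)
qed

instantiation ell2 :: (type) real_inner
begin

lift_definition zero_ell2 :: "'a ell2" is "\<lambda>_. 0" by simp

lift_definition plus_ell2 :: "'a ell2 \<Rightarrow> 'a ell2 \<Rightarrow> 'a ell2" is "\<lambda>f g x. f x + g x"
  by (rule ell2_add_summable)

lift_definition uminus_ell2 :: "'a ell2 \<Rightarrow> 'a ell2" is "\<lambda>f x. - f x" by simp

lift_definition minus_ell2 :: "'a ell2 \<Rightarrow> 'a ell2 \<Rightarrow> 'a ell2" is "\<lambda>f g x. f x - g x"
  using ell2_add_summable[of _ "\<lambda>x. - _ x"] by simp

lift_definition scaleR_ell2 :: "real \<Rightarrow> 'a ell2 \<Rightarrow> 'a ell2" is "\<lambda>r f x. r *\<^sub>R f x"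
  using ell2_scale_summable[of _ "of_real _"] by (simp add: scaleR_conv_of_real)

text \<open>This is the real part of the complex inner product, which is defined below.\<close>

lift_definition inner_ell2 :: "'a ell2 \<Rightarrow> 'a ell2 \<Rightarrow> real"
  is "\<lambda>f g. \<Sum>\<^sub>\<infinity>x. inner (f x) (g x)" .

definition norm_ell2 :: "'a ell2 \<Rightarrow> real" where "norm_ell2 f = sqrt (inner f f)"
definition sgn_ell2 :: "'a ell2 \<Rightarrow> 'a ell2" where "sgn_ell2 f = inverse (norm f) *\<^sub>R f"
definition dist_ell2 :: "'a ell2 \<Rightarrow> 'a ell2 \<Rightarrow> real" where "dist_ell2 f g = norm (f - g)"
definition uniformity_ell2 :: "('a ell2 \<times> 'a ell2) filter" where
  "uniformity_ell2 = (INF e\<in>{0<..}. principal {(x, y). dist x y < e})"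
definition open_ell2 :: "'a ell2 set \<Rightarrow> bool" where
  "open_ell2 U = (\<forall>x\<in>U. \<forall>\<^sub>F (x', y) in uniformity. x' = x \<longrightarrow> y \<in> U)"

instance
proof
  fix x y z :: "'a ell2" and a b :: real
  show "x + y + z = x + (y + z)" by transfer (auto simp: algebra_simps)
  show "x + y = y + x" by transfer (auto simp: algebra_simps)
  show "0 + x = x" by transfer auto
  show "- x + x = 0" by transfer auto
  show "x - y = x + - y" by transfer auto
  show "a *\<^sub>R (x + y) = a *\<^sub>R x + a *\<^sub>R y" by transfer (auto simp: algebra_simps)
  show "(a + b) *\<^sub>R x = a *\<^sub>R x + b *\<^sub>R x" by transfer (auto simp: algebra_simps)
  show "a *\<^sub>R b *\<^sub>R x = (a * b) *\<^sub>R x" by transfer auto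
  show "1 *\<^sub>R x = x" by transfer auto
  show "sgn x = inverse (norm x) *\<^sub>R x" by (simp add: sgn_ell2_def)
  show "dist x y = norm (x - y)" by (rule dist_ell2_def)
  show "uniformity = (INF e\<in>{0<..}. principal {(x, y :: 'a ell2). dist x y < e})"
    by (rule uniformity_ell2_def)
  show "inner x y = inner y x" by transfer (simp add: inner_commute)
  show "inner (x + y) z = inner x z + inner y z"
    by transfer (simp add: inner_add_left infsum_add ell2_inner_summable)
  show "inner (a *\<^sub>R x) y = a * inner x y"
    by transfer (simp add: infsum_cmult_right ell2_inner_summable)
  show "0 \<le> inner x x" by transfer (simp add: infsum_nonneg)
  show "(inner x x = 0) = (x = 0)"
  proof transfer
    fix f :: "'a \<Rightarrow> complex"
    assume f: "(\<lambda>x. (cmod (f x))\<^sup>2) summable_on UNIV"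
    have "f x = 0" if "(\<Sum>\<^sub>\<infinity>x. inner (f x) (f x)) = 0" for x
    proof -
      have "inner (f x) (f x) = 0"
        by (rule nonneg_infsum_le_0D[where A = UNIV]) (simp_all add: that ell2_inner_summable[OF f f])
      then show ?thesis by simp
    qed
    moreover have "(\<Sum>\<^sub>\<infinity>x. inner (f x) (f x)) = 0" if "f = (\<lambda>_. 0)"
      unfolding that by simp
    ultimately show "((\<Sum>\<^sub>\<infinity>x. inner (f x) (f x)) = 0) = (f = (\<lambda>_. 0))"
      by (intro iffI ext)
  qed
  show "norm x = sqrt (inner x x)" by (rule norm_ell2_def)
qed (rule open_ell2_def)

end

lift_definition cinner :: "'a ell2 \<Rightarrow> 'a ell2 \<Rightarrow> complex" is "\<lambda>f g. \<Sum>\<^sub>\<infinity>x. cnj (f x) * g x" .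

lift_definition scaleC :: "complex \<Rightarrow> 'a ell2 \<Rightarrow> 'a ell2" is "\<lambda>c f x. c * f x"
  by (rule ell2_scale_summable)

text \<open>\<^typ>\<open>'a ell2 \<Rightarrow>\<^sub>L 'a ell2\<close> is the type of bounded real linear operators with the operator
  norm; the operators occurring below are moreover complex linear.\<close>

definition complex_linear :: "('a ell2 \<Rightarrow>\<^sub>L 'a ell2) \<Rightarrow> bool" where
  "complex_linear T \<longleftrightarrow> (\<forall>c x. blinfun_apply T (scaleC c x) = scaleC c (blinfun_apply T x))"

definition scale_op :: "complex \<Rightarrow> ('a ell2 \<Rightarrow>\<^sub>L 'a ell2) \<Rightarrow> ('a ell2 \<Rightarrow>\<^sub>L 'a ell2)" where
  "scale_op c T = Blinfun (\<lambda>x. scaleC c (blinfun_apply T x))"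

definition adjoint_op :: "('a ell2 \<Rightarrow>\<^sub>L 'a ell2) \<Rightarrow> ('a ell2 \<Rightarrow>\<^sub>L 'a ell2)" where
  "adjoint_op T = (THE S. \<forall>x y. cinner (blinfun_apply S x) y = cinner x (blinfun_apply T y))"

definition unitary_op :: "('a ell2 \<Rightarrow>\<^sub>L 'a ell2) \<Rightarrow> bool" where
  "unitary_op T \<longleftrightarrow> complex_linear T \<and> surj (blinfun_apply T) \<and>
     (\<forall>x y. cinner (blinfun_apply T x) (blinfun_apply T y) = cinner x y)"


section \<open>C*-algebras\<close>

definition complex_ring :: "complex ring" where
  "complex_ring = \<lparr>carrier = UNIV, mult = (*), one = 1, zero = 0, add = (+)\<rparr>"

text \<open>C*-algebras with explicit carriers. They are not assumed to be unital: the field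
  \<^const>\<open>one\<close>, inherited from the module record, is not constrained.\<close>

record 'a star_algebra = "(complex, 'a) module" +
  star :: "'a \<Rightarrow> 'a"
  cnorm :: "'a \<Rightarrow> real"

locale cstar_algebra = module complex_ring A for A :: "'a star_algebra" (structure) +
  assumes mult_closed: "\<lbrakk>x \<in> carrier A; y \<in> carrier A\<rbrakk> \<Longrightarrow> x \<otimes> y \<in> carrier A"
    and mult_assoc: "\<lbrakk>x \<in> carrier A; y \<in> carrier A; z \<in> carrier A\<rbrakk> \<Longrightarrow> (x \<otimes> y) \<otimes> z = x \<otimes> (y \<otimes> z)"
    and mult_add_left: "\<lbrakk>x \<in> carrier A; y \<in> carrier A; z \<in> carrier A\<rbrakk> \<Longrightarrow> (x \<oplus> y) \<otimes> z = x \<otimes> z \<oplus> y \<otimes> z"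
    and mult_add_right: "\<lbrakk>x \<in> carrier A; y \<in> carrier A; z \<in> carrier A\<rbrakk> \<Longrightarrow> z \<otimes> (x \<oplus> y) = z \<otimes> x \<oplus> z \<otimes> y"
    and smult_mult_left: "\<lbrakk>x \<in> carrier A; y \<in> carrier A\<rbrakk> \<Longrightarrow> (c \<odot> x) \<otimes> y = c \<odot> (x \<otimes> y)"
    and smult_mult_right: "\<lbrakk>x \<in> carrier A; y \<in> carrier A\<rbrakk> \<Longrightarrow> x \<otimes> (c \<odot> y) = c \<odot> (x \<otimes> y)"
    and star_closed: "x \<in> carrier A \<Longrightarrow> star A x \<in> carrier A"
    and star_star: "x \<in> carrier A \<Longrightarrow> star A (star A x) = x"
    and star_add: "\<lbrakk>x \<in> carrier A; y \<in> carrier A\<rbrakk> \<Longrightarrow> star A (x \<oplus> y) = star A x \<oplus> star A y"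
    and star_smult: "x \<in> carrier A \<Longrightarrow> star A (c \<odot> x) = cnj c \<odot> star A x"
    and star_mult: "\<lbrakk>x \<in> carrier A; y \<in> carrier A\<rbrakk> \<Longrightarrow> star A (x \<otimes> y) = star A y \<otimes> star A x"
    and cnorm_nonneg: "x \<in> carrier A \<Longrightarrow> 0 \<le> cnorm A x"
    and cnorm_eq_0_iff: "x \<in> carrier A \<Longrightarrow> cnorm A x = 0 \<longleftrightarrow> x = \<zero>"
    and cnorm_triangle: "\<lbrakk>x \<in> carrier A; y \<in> carrier A\<rbrakk> \<Longrightarrow> cnorm A (x \<oplus> y) \<le> cnorm A x + cnorm A y"
    and cnorm_smult: "x \<in> carrier A \<Longrightarrow> cnorm A (c \<odot> x) = cmod c * cnorm A x"
    and cnorm_mult: "\<lbrakk>x \<in> carrier A; y \<in> carrier A\<rbrakk> \<Longrightarrow> cnorm A (x \<otimes> y) \<le> cnorm A x * cnorm A y"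
    and cstar_identity: "x \<in> carrier A \<Longrightarrow> cnorm A (star A x \<otimes> x) = (cnorm A x)\<^sup>2"
    and complete:
      "\<lbrakk>\<And>n :: nat. X n \<in> carrier A;
        \<And>e. 0 < e \<Longrightarrow> \<exists>N. \<forall>m\<ge>N. \<forall>n\<ge>N. cnorm A (X m \<ominus> X n) < e\<rbrakk>
       \<Longrightarrow> \<exists>x\<in>carrier A. (\<lambda>n. cnorm A (X n \<ominus> x)) \<longlonglongrightarrow> 0"

definition finite_dimensional :: "'a star_algebra \<Rightarrow> bool" where
  "finite_dimensional A \<longleftrightarrow>
     (\<exists>S. finite S \<and> S \<subseteq> carrier A \<and>
        (\<forall>x\<in>carrier A. \<exists>c. x = (\<Oplus>\<^bsub>A\<^esub>s\<in>S. c s \<odot>\<^bsub>A\<^esub> s)))"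

definition star_hom :: "'a star_algebra \<Rightarrow> 'b star_algebra \<Rightarrow> ('a \<Rightarrow> 'b) set" where
  "star_hom A B = {\<pi>. \<pi> \<in> carrier A \<rightarrow> carrier B \<and>
     (\<forall>x\<in>carrier A. \<forall>y\<in>carrier A. \<pi> (x \<oplus>\<^bsub>A\<^esub> y) = \<pi> x \<oplus>\<^bsub>B\<^esub> \<pi> y) \<and>
     (\<forall>c. \<forall>x\<in>carrier A. \<pi> (c \<odot>\<^bsub>A\<^esub> x) = c \<odot>\<^bsub>B\<^esub> \<pi> x) \<and>
     (\<forall>x\<in>carrier A. \<forall>y\<in>carrier A. \<pi> (x \<otimes>\<^bsub>A\<^esub> y) = \<pi> x \<otimes>\<^bsub>B\<^esub> \<pi> y) \<and>
     (\<forall>x\<in>carrier A. \<pi> (star A x) = star B (\<pi> x))}"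

text \<open>A bound variable must have a fixed type, so the finite dimensional C*-algebras \<open>B\<close> have elements in
  \<^typ>\<open>nat \<Rightarrow> complex\<close>. This is no restriction, as a finite dimensional C*-algebra over any type is
  isomorphic to such a \<open>B\<close>, via coordinates; see \<open>residually_finite_dimensionalI\<close>.\<close>

definition residually_finite_dimensional :: "'a star_algebra \<Rightarrow> bool" where
  "residually_finite_dimensional R \<longleftrightarrow>
     (\<forall>x\<in>carrier R. x \<noteq> \<zero>\<^bsub>R\<^esub> \<longrightarrow>
        (\<exists>(B :: (nat \<Rightarrow> complex) star_algebra) \<pi>.
           cstar_algebra B \<and> finite_dimensional B \<and> \<pi> \<in> star_hom R B \<and> \<pi> x \<noteq> \<zero>\<^bsub>B\<^esub>))"

text \<open>Transport of structure along a map that is injective on the carrier.\<close>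

definition transport :: "('b \<Rightarrow> 'a) \<Rightarrow> 'b star_algebra \<Rightarrow> 'a star_algebra" where
  "transport f B =
     (let g = the_inv_into (carrier B) f in
      \<lparr>carrier = f ` carrier B,
       mult = (\<lambda>x y. f (g x \<otimes>\<^bsub>B\<^esub> g y)), one = f \<one>\<^bsub>B\<^esub>,
       zero = f \<zero>\<^bsub>B\<^esub>, add = (\<lambda>x y. f (g x \<oplus>\<^bsub>B\<^esub> g y)),
       smult = (\<lambda>c x. f (c \<odot>\<^bsub>B\<^esub> g x)),
       star = (\<lambda>x. f (star B (g x))), cnorm = (\<lambda>x. cnorm B (g x))\<rparr>)"

lemma transport_cstar_algebra:
  assumes B: "cstar_algebra B" and inj: "inj_on f (carrier B)"
  shows "cstar_algebra (transport f B)" and "f \<in> star_hom B (transport f B)"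
    and "finite_dimensional B \<Longrightarrow> finite_dimensional (transport f B)"
proof -
  interpret B: cstar_algebra B by (rule B)
  let ?T = "transport f B"
  have g: "the_inv_into (carrier B) f (f x) = x" if "x \<in> carrier B" for x
    using inj that by (rule the_inv_into_f_f)
  note [simp] = B.mult_closed B.star_closed
  have UNIV_C [simp]: "c \<in> carrier complex_ring" for c by (simp add: complex_ring_def)
  have sm [simp]: "c \<odot>\<^bsub>B\<^esub> x \<in> carrier B" if "x \<in> carrier B" for c x
    using that by (rule B.smult_closed[OF UNIV_C])
  have car: "carrier ?T = f ` carrier B" and zero: "\<zero>\<^bsub>?T\<^esub> = f \<zero>\<^bsub>B\<^esub>"
    by (simp_all add: transport_def Let_def)
  have add: "f x \<oplus>\<^bsub>?T\<^esub> f y = f (x \<oplus>\<^bsub>B\<^esub> y)"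
    and mult: "f x \<otimes>\<^bsub>?T\<^esub> f y = f (x \<otimes>\<^bsub>B\<^esub> y)"
    if "x \<in> carrier B" "y \<in> carrier B" for x y
    using that by (simp_all add: transport_def Let_def g)
  have smult: "c \<odot>\<^bsub>?T\<^esub> f x = f (c \<odot>\<^bsub>B\<^esub> x)" and star: "star ?T (f x) = f (star B x)"
    and cnorm: "cnorm ?T (f x) = cnorm B x"
    if "x \<in> carrier B" for x c
    using that by (simp_all add: transport_def Let_def g)
  note ops = add mult smult star cnorm
  have f_eq: "f x = f y \<longleftrightarrow> x = y" if "x \<in> carrier B" "y \<in> carrier B" for x y
    using inj that by (simp add: inj_on_eq_iff)
  have grp: "abelian_group ?T"
  proof (rule abelian_groupI)
    fix x assume "x \<in> carrier ?T"
    then obtain a where "a \<in> carrier B" "x = f a" by (auto simp: car)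
    then show "\<exists>y\<in>carrier ?T. y \<oplus>\<^bsub>?T\<^esub> x = \<zero>\<^bsub>?T\<^esub>"
      by (intro bexI[of _ "f (\<ominus>\<^bsub>B\<^esub> a)"]) (simp_all add: car zero ops B.M.l_neg)
  qed (auto simp: car zero ops B.M.a_assoc B.M.a_comm B.M.a_lcomm)
  interpret T: abelian_group ?T by (rule grp)
  have neg: "\<ominus>\<^bsub>?T\<^esub> f x = f (\<ominus>\<^bsub>B\<^esub> x)" if "x \<in> carrier B" for x
    using that by (intro T.minus_equality) (simp_all add: car zero ops B.M.l_neg)
  have minus: "f x \<ominus>\<^bsub>?T\<^esub> f y = f (x \<ominus>\<^bsub>B\<^esub> y)" if "x \<in> carrier B" "y \<in> carrier B" for x y
    using that by (simp add: a_minus_def neg ops)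
  have mod: "module complex_ring ?T"
    by (rule moduleI[OF B.is_cring grp])
      (auto simp: car ops B.smult_l_distr B.smult_r_distr B.smult_assoc1)
  show "cstar_algebra ?T"
  proof (rule cstar_algebra.intro[OF mod], unfold_locales)
    fix X :: "nat \<Rightarrow> 'b"
    assume X: "\<And>n. X n \<in> carrier ?T"
      and cauchy: "\<And>e. 0 < e \<Longrightarrow> \<exists>N. \<forall>m\<ge>N. \<forall>n\<ge>N. cnorm ?T (X m \<ominus>\<^bsub>?T\<^esub> X n) < e"
    from X have "\<forall>n. \<exists>y. y \<in> carrier B \<and> X n = f y" by (auto simp: car)
    then obtain Y where Y: "\<And>n. Y n \<in> carrier B" "\<And>n. X n = f (Y n)" by metis
    have "\<exists>y\<in>carrier B. (\<lambda>n. cnorm B (Y n \<ominus>\<^bsub>B\<^esub> y)) \<longlonglongrightarrow> 0"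
      by (rule B.complete) (use cauchy Y in \<open>simp_all add: minus ops\<close>)
    then obtain y where y: "y \<in> carrier B" "(\<lambda>n. cnorm B (Y n \<ominus>\<^bsub>B\<^esub> y)) \<longlonglongrightarrow> 0" by blast
    show "\<exists>x\<in>carrier ?T. (\<lambda>n. cnorm ?T (X n \<ominus>\<^bsub>?T\<^esub> x)) \<longlonglongrightarrow> 0"
      by (rule bexI[of _ "f y"]) (use y Y in \<open>simp_all add: minus ops car\<close>)
  qed (auto simp: car zero ops f_eq B.mult_assoc B.mult_add_left B.mult_add_right B.smult_mult_left
      B.smult_mult_right B.star_star B.star_add B.star_smult B.star_mult B.cnorm_nonneg
      B.cnorm_eq_0_iff B.cnorm_triangle B.cnorm_smult B.cnorm_mult B.cstar_identity)
  show "f \<in> star_hom B ?T"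
    by (auto simp: star_hom_def car ops)
  show "finite_dimensional ?T" if "finite_dimensional B"
  proof -
    from that obtain S where S: "finite S" "S \<subseteq> carrier B"
      "\<And>x. x \<in> carrier B \<Longrightarrow> \<exists>c. x = (\<Oplus>\<^bsub>B\<^esub>s\<in>S. c s \<odot>\<^bsub>B\<^esub> s)"
      unfolding finite_dimensional_def by metis
    have fin: "f (\<Oplus>\<^bsub>B\<^esub>s\<in>S. c s \<odot>\<^bsub>B\<^esub> s) = (\<Oplus>\<^bsub>?T\<^esub>t\<in>f ` S. c (the_inv_into (carrier B) f t) \<odot>\<^bsub>?T\<^esub> t)" for c
      using S(1,2)
    proof (induction S)
      case empty
      then show ?case by (simp add: zero)
    next
      case (insert s S)
      then have s: "s \<in> carrier B" and S: "S \<subseteq> carrier B" by auto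
      have fs: "f s \<notin> f ` S" using insert(2) s S by (auto simp: f_eq subset_iff)
      have cl: "(\<Oplus>\<^bsub>B\<^esub>s\<in>S. c s \<odot>\<^bsub>B\<^esub> s) \<in> carrier B"
        using S by (intro B.M.finsum_closed) auto
      have "(\<Oplus>\<^bsub>B\<^esub>s\<in>insert s S. c s \<odot>\<^bsub>B\<^esub> s) = c s \<odot>\<^bsub>B\<^esub> s \<oplus>\<^bsub>B\<^esub> (\<Oplus>\<^bsub>B\<^esub>s\<in>S. c s \<odot>\<^bsub>B\<^esub> s)"
        using insert(1,2) s S by (intro B.M.finsum_insert) auto
      then have "f (\<Oplus>\<^bsub>B\<^esub>s\<in>insert s S. c s \<odot>\<^bsub>B\<^esub> s) =
          f (c s \<odot>\<^bsub>B\<^esub> s) \<oplus>\<^bsub>?T\<^esub> f (\<Oplus>\<^bsub>B\<^esub>s\<in>S. c s \<odot>\<^bsub>B\<^esub> s)"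
        using s cl by (simp add: add)
      also have "\<dots> = c (the_inv_into (carrier B) f (f s)) \<odot>\<^bsub>?T\<^esub> f s \<oplus>\<^bsub>?T\<^esub>
          (\<Oplus>\<^bsub>?T\<^esub>t\<in>f ` S. c (the_inv_into (carrier B) f t) \<odot>\<^bsub>?T\<^esub> t)"
        using s insert.IH[OF S] by (simp add: smult g)
      also have "\<dots> = (\<Oplus>\<^bsub>?T\<^esub>t\<in>f ` insert s S. c (the_inv_into (carrier B) f t) \<odot>\<^bsub>?T\<^esub> t)"
        unfolding image_insert using insert(1) s S fs
        by (intro T.finsum_insert[symmetric]) (auto simp: car smult g subset_iff)
      finally show ?case .
    qed
    have "\<exists>c. x = (\<Oplus>\<^bsub>?T\<^esub>t\<in>f ` S. c t \<odot>\<^bsub>?T\<^esub> t)" if "x \<in> carrier ?T" for x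
      using that S(3) fin by (force simp: car)
    then show ?thesis
      unfolding finite_dimensional_def using S(1,2)
      by (intro exI[of _ "f ` S"]) (auto simp: car)
  qed
qed

lemma finite_dimensional_coordinates:
  assumes "cstar_algebra B" "finite_dimensional B"
  shows "\<exists>f :: 'b \<Rightarrow> nat \<Rightarrow> complex. inj_on f (carrier B)"
proof -
  interpret B: cstar_algebra B by fact
  obtain S where S: "finite S" "S \<subseteq> carrier B"
    "\<And>x. x \<in> carrier B \<Longrightarrow> \<exists>c. x = (\<Oplus>\<^bsub>B\<^esub>s\<in>S. c s \<odot>\<^bsub>B\<^esub> s)"
    using assms(2) unfolding finite_dimensional_def by metis
  obtain c where c: "\<And>x. x \<in> carrier B \<Longrightarrow> x = (\<Oplus>\<^bsub>B\<^esub>s\<in>S. c x s \<odot>\<^bsub>B\<^esub> s)"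
    using S(3) by metis
  obtain h :: "nat \<Rightarrow> 'b" and n where h: "S = h ` {i. i < n}"
    using S(1) by (metis finite_imp_nat_seg_image_inj_on)
  have "inj_on (\<lambda>x i. c x (h i)) (carrier B)"
  proof (rule inj_onI)
    fix x y assume xy: "x \<in> carrier B" "y \<in> carrier B" and eq: "(\<lambda>i. c x (h i)) = (\<lambda>i. c y (h i))"
    have "c x s = c y s" if "s \<in> S" for s
      using that eq unfolding h by (auto dest: fun_cong)
    moreover have "(\<lambda>s. c y s \<odot>\<^bsub>B\<^esub> s) \<in> S \<rightarrow> carrier B"
      using S(2) by (auto simp: complex_ring_def intro!: B.smult_closed)
    ultimately have "(\<Oplus>\<^bsub>B\<^esub>s\<in>S. c x s \<odot>\<^bsub>B\<^esub> s) = (\<Oplus>\<^bsub>B\<^esub>s\<in>S. c y s \<odot>\<^bsub>B\<^esub> s)"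
      by (intro B.M.finsum_cong') auto
    then show "x = y" using c xy by metis
  qed
  then show ?thesis by blast
qed

lemma residually_finite_dimensionalI:
  assumes "\<And>x. x \<in> carrier R \<Longrightarrow> x \<noteq> \<zero>\<^bsub>R\<^esub> \<Longrightarrow>
     \<exists>(B :: 'b star_algebra) \<pi>. cstar_algebra B \<and> finite_dimensional B \<and> \<pi> \<in> star_hom R B \<and> \<pi> x \<noteq> \<zero>\<^bsub>B\<^esub>"
  shows "residually_finite_dimensional R"
  unfolding residually_finite_dimensional_def
proof (intro ballI impI)
  fix x assume x: "x \<in> carrier R" "x \<noteq> \<zero>\<^bsub>R\<^esub>"
  from assms[OF x] obtain B :: "'b star_algebra" and \<pi>
    where B: "cstar_algebra B" "finite_dimensional B" and \<pi>: "\<pi> \<in> star_hom R B" "\<pi> x \<noteq> \<zero>\<^bsub>B\<^esub>"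
    by blast
  interpret B: cstar_algebra B by fact
  from finite_dimensional_coordinates[OF B] obtain f :: "'b \<Rightarrow> nat \<Rightarrow> complex"
    where f: "inj_on f (carrier B)" by blast
  note T = transport_cstar_algebra[OF B(1) f]
  have "f (\<pi> x) \<noteq> f \<zero>\<^bsub>B\<^esub>"
    using f \<pi> x by (auto simp: star_hom_def inj_on_def)
  then have "(f \<circ> \<pi>) x \<noteq> \<zero>\<^bsub>transport f B\<^esub>"
    by (simp add: transport_def Let_def)
  moreover have "f \<circ> \<pi> \<in> star_hom R (transport f B)"
    using T(2) \<pi>(1) by (auto simp: star_hom_def Pi_iff)
  ultimately show "\<exists>(B :: (nat \<Rightarrow> complex) star_algebra) \<pi>.
      cstar_algebra B \<and> finite_dimensional B \<and> \<pi> \<in> star_hom R B \<and> \<pi> x \<noteq> \<zero>\<^bsub>B\<^esub>"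
    using T(1) T(3)[OF B(2)] by blast
qed


section \<open>Group C*-algebras\<close>

text \<open>Here \<open>G\<close> is a discrete group whose carrier is the whole type.\<close>

definition left_translation :: "'g monoid \<Rightarrow> 'g \<Rightarrow> ('g ell2 \<Rightarrow>\<^sub>L 'g ell2)" where
  "left_translation G g =
     Blinfun (\<lambda>\<psi>. Abs_ell2 (\<lambda>h. Rep_ell2 \<psi> (inv\<^bsub>G\<^esub> g \<otimes>\<^bsub>G\<^esub> h)))"

definition op_span :: "('g \<Rightarrow> ('a ell2 \<Rightarrow>\<^sub>L 'a ell2)) \<Rightarrow> ('a ell2 \<Rightarrow>\<^sub>L 'a ell2) set" where
  "op_span U = {\<Sum>g\<in>S. scale_op (c g) (U g) | S c. finite S}"

definition reduced_group_cstar :: "'g monoid \<Rightarrow> ('g ell2 \<Rightarrow>\<^sub>L 'g ell2) star_algebra" where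
  "reduced_group_cstar G =
     \<lparr>carrier = closure (op_span (left_translation G)),
      mult = (o\<^sub>L), one = id_blinfun, zero = 0, add = (+), smult = scale_op,
      star = adjoint_op, cnorm = norm\<rparr>"

text \<open>The full group C*-algebra is the completion of the group algebra in the norm
  \<open>a \<mapsto> sup \<parallel>\<pi>(a)\<parallel>\<close> over all unitary representations \<open>\<pi>\<close>. It is realised in the universal
  representation, i.e. as the norm closure of the linear span of the unitaries \<open>(\<pi>(g))\<^sub>\<pi>\<close> in the algebra of
  bounded families of operators indexed by the unitary representations \<open>\<pi>\<close>. It suffices to
  consider representations on the Hilbert space \<^typ>\<open>('g \<times> nat) ell2\<close>: the norm is a supremum over
  cyclic representations, these have dimension at most \<open>|G \<times> \<nat>|\<close>, and so a suitable multiple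
  of each, which gives the same norm, acts on \<^typ>\<open>('g \<times> nat) ell2\<close>.\<close>

type_synonym 'g representation = "'g \<Rightarrow> (('g \<times> nat) ell2 \<Rightarrow>\<^sub>L ('g \<times> nat) ell2)"

definition unitary_reps :: "'g monoid \<Rightarrow> 'g representation set" where
  "unitary_reps G = {\<pi>. (\<forall>g. unitary_op (\<pi> g)) \<and> (\<forall>g h. \<pi> (g \<otimes>\<^bsub>G\<^esub> h) = \<pi> g o\<^sub>L \<pi> h)}"

type_synonym 'g family = "'g representation \<Rightarrow> (('g \<times> nat) ell2 \<Rightarrow>\<^sub>L ('g \<times> nat) ell2)"

definition universal_span :: "'g monoid \<Rightarrow> 'g family set" where
  "universal_span G =
     {\<lambda>\<pi>. if \<pi> \<in> unitary_reps G then \<Sum>g\<in>S. scale_op (c g) (\<pi> g) else 0 | S c. finite S}"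

definition full_group_cstar :: "'g monoid \<Rightarrow> 'g family star_algebra" where
  "full_group_cstar G =
     \<lparr>carrier = {a. (\<forall>\<pi>. \<pi> \<notin> unitary_reps G \<longrightarrow> a \<pi> = 0) \<and>
                   (\<exists>s. (\<forall>n. s n \<in> universal_span G) \<and>
                        uniform_limit (unitary_reps G) s a sequentially)},
      mult = (\<lambda>a b \<pi>. a \<pi> o\<^sub>L b \<pi>),
      one = (\<lambda>\<pi>. if \<pi> \<in> unitary_reps G then id_blinfun else 0),
      zero = (\<lambda>\<pi>. 0),
      add = (\<lambda>a b \<pi>. a \<pi> + b \<pi>),
      smult = (\<lambda>c a \<pi>. scale_op c (a \<pi>)),
      star = (\<lambda>a \<pi>. if \<pi> \<in> unitary_reps G then adjoint_op (a \<pi>) else 0),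
      cnorm = (\<lambda>a. SUP \<pi>\<in>unitary_reps G. norm (a \<pi>))\<rparr>"

end

theory Submission
  imports Defs
begin

text \<open>
  Both algebras contain a copy \<open>u\<close> of the group \<open>F\<close>, and a single element \<open>u(ab) - u(ba) \<noteq> 0\<close> with
  \<open>ab \<noteq> ba\<close> is annihilated by every homomorphism to a finite dimensional algebra. The reason is
  that \<open>F\<close> contains infinitely many pairwise commuting copies of itself, all conjugate to each
  other, and finite dimensional algebras have no room for this.

  Let \<open>a\<close>, \<open>b\<close> be elements of \<open>F\<close> supported in \<open>[1/2, 5/8]\<close> that do not commute, and let \<open>c\<close> push
  \<open>[1/2, 5/8]\<close> off itself, with \<open>c(5/8) \<le> 1/2\<close> and \<open>c(x) \<le> x\<close> everywhere. The pairs
  \<open>a\<^sub>i = c\<^sup>i a c\<^sup>-\<^sup>i\<close>, \<open>b\<^sub>i = c\<^sup>i b c\<^sup>-\<^sup>i\<close> then have supports with disjoint interiors for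
  different \<open>i\<close>, so that \<open>a\<^sub>i\<close> commutes with \<open>b\<^sub>j\<close> for \<open>i \<noteq> j\<close>. Map the group to a finite
  dimensional algebra \<open>B\<close>. The images of the \<open>b\<^sub>i\<close> are linearly dependent: some nontrivial
  combination of finitely many of them, with nonzero coefficient at \<open>b\<^sub>k\<close> say, vanishes. Commuting
  it with \<open>a\<^sub>k\<close> removes all other terms, so the images of \<open>a\<^sub>k\<close> and \<open>b\<^sub>k\<close> commute. Conjugating
  back, the images of \<open>a\<close> and \<open>b\<close> commute, which means that \<open>u(ab) - u(ba)\<close> is mapped to zero. The
  lemmas that carry this argument are \<open>finite_dimensional_commuting_pair\<close> and
  \<open>not_residually_finite_dimensionalI\<close>.

  That \<open>u(ab) \<noteq> u(ba)\<close> holds in the reduced algebra because left translations are distinguished by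
  their values at point masses, and in the full algebra because the regular representation, with
  multiplicity \<open>\<nat>\<close>, is among the representations that define it.

  The remaining work is to show that \<open>F\<close> is a group. The definition of its elements by breakpoints
  and derivatives does not behave well under composition, as breakpoints of a composition arise as
  preimages of breakpoints. The maps are therefore described by \<open>dyadic_pl\<close>, which builds them
  from affine pieces \<open>x \<mapsto> 2\<^sup>k x + q\<close> with dyadic \<open>q\<close> on intervals with dyadic endpoints; closure
  under composition and inversion is then an induction, and \<open>thompson_map_iff\<close> shows that the two
  descriptions agree.
\<close>

section \<open>Commuting families in finite dimensional algebras\<close>

text \<open>A nontrivial linear relation between the \<open>v i\<close> expresses some \<open>v k\<close> by vectors that lie in
  \<open>C k\<close>. The induction on the spanning set is Gaussian elimination: the vectors \<open>w i\<close>, obtained by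
  eliminating a generator with the help of a pivot vector \<open>v k\<close>, satisfy the same hypotheses for
  \<open>i \<noteq> k\<close>, since \<open>v k\<close> is in \<open>C i\<close>; and \<open>w i\<close> is in \<open>C i\<close> exactly if \<open>v i\<close> is.\<close>

lemma (in module) exists_member_of_own_submodule:
  assumes field: "field R" and S: "finite S" "S \<subseteq> carrier M"
    and I: "infinite I"
    and C: "\<And>i. i \<in> I \<Longrightarrow> submodule (C i) R M"
    and v: "\<And>i. i \<in> I \<Longrightarrow> \<exists>c. c \<in> S \<rightarrow> carrier R \<and> v i = (\<Oplus>\<^bsub>M\<^esub>s\<in>S. c s \<odot>\<^bsub>M\<^esub> s)"
    and vC: "\<And>i j. i \<in> I \<Longrightarrow> j \<in> I \<Longrightarrow> i \<noteq> j \<Longrightarrow> v j \<in> C i"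
  shows "\<exists>i\<in>I. v i \<in> C i"
  using S I C v vC
proof (induction S arbitrary: I v)
  case empty
  obtain i where i: "i \<in> I"
    using empty.prems(2) by fastforce
  then have "v i = \<zero>\<^bsub>M\<^esub>" using empty.prems(4) by fastforce
  then show ?case
    using i empty.prems(3)[OF i] subgroup.one_closed[of "C i" "add_monoid M"]
    unfolding submodule_def by (intro bexI[of _ i]) auto
next
  case (insert s S)
  have s: "s \<in> carrier M" and S: "S \<subseteq> carrier M" using insert.prems by auto
  obtain c where c: "\<And>i. i \<in> I \<Longrightarrow> c i \<in> insert s S \<rightarrow> carrier R"
      "\<And>i. i \<in> I \<Longrightarrow> v i = (\<Oplus>\<^bsub>M\<^esub>t\<in>insert s S. c i t \<odot>\<^bsub>M\<^esub> t)"
    using insert.prems(4) by metis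
  have split: "v i = c i s \<odot>\<^bsub>M\<^esub> s \<oplus>\<^bsub>M\<^esub> (\<Oplus>\<^bsub>M\<^esub>t\<in>S. c i t \<odot>\<^bsub>M\<^esub> t)"
    and cs: "c i s \<in> carrier R" and cS: "c i \<in> S \<rightarrow> carrier R"
    and fin: "(\<Oplus>\<^bsub>M\<^esub>t\<in>S. c i t \<odot>\<^bsub>M\<^esub> t) \<in> carrier M" if "i \<in> I" for i
  proof -
    have *: "c i t \<odot>\<^bsub>M\<^esub> t \<in> carrier M" if "t \<in> insert s S" for t
      using c(1)[OF \<open>i \<in> I\<close>] s S that by (intro smult_closed) auto
    show "c i s \<in> carrier R" "c i \<in> S \<rightarrow> carrier R"
      using c(1)[OF \<open>i \<in> I\<close>] by auto
    show "(\<Oplus>\<^bsub>M\<^esub>t\<in>S. c i t \<odot>\<^bsub>M\<^esub> t) \<in> carrier M"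
      using * by (intro M.finsum_closed) auto
    show "v i = c i s \<odot>\<^bsub>M\<^esub> s \<oplus>\<^bsub>M\<^esub> (\<Oplus>\<^bsub>M\<^esub>t\<in>S. c i t \<odot>\<^bsub>M\<^esub> t)"
      unfolding c(2)[OF that] using insert.hyps * by (intro M.finsum_insert) auto
  qed
  show ?case
  proof (cases "\<exists>k\<in>I. c k s \<noteq> \<zero>")
    case False
    show ?thesis
    proof (rule insert.IH[OF S insert.prems(2,3)])
      fix i assume i: "i \<in> I"
      have "v i = (\<Oplus>\<^bsub>M\<^esub>t\<in>S. c i t \<odot>\<^bsub>M\<^esub> t)"
        using split[OF i] False i s fin[OF i] by (auto simp: smult_l_null)
      then show "\<exists>c. c \<in> S \<rightarrow> carrier R \<and> v i = (\<Oplus>\<^bsub>M\<^esub>t\<in>S. c t \<odot>\<^bsub>M\<^esub> t)"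
        using cS[OF i] by blast
    qed (use insert.prems in auto)
  next
    case True
    then obtain k where k: "k \<in> I" "c k s \<noteq> \<zero>" by blast
    \<comment> \<open>The factor for which \<open>w i\<close> has no component at the generator \<open>s\<close>.\<close>
    define r where "r i = \<ominus> (c i s \<otimes> inv c k s)" for i
    have unit: "c k s \<in> Units R"
      using field.field_Units[OF field] k cs[OF k(1)] by simp
    have r: "r i \<in> carrier R" and rk: "r i \<otimes> c k s = \<ominus> c i s" if "i \<in> I" for i
      using cs[OF that] cs[OF k(1)] unit
      by (simp_all add: r_def R.l_minus R.m_assoc)
    define w where "w i = v i \<oplus>\<^bsub>M\<^esub> r i \<odot>\<^bsub>M\<^esub> v k" for i
    have vM: "v i \<in> carrier M" if "i \<in> I" for i
      using split[OF that] s cs[OF that] fin[OF that] by simp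
    have "\<exists>i\<in>I - {k}. w i \<in> C i"
    proof (rule insert.IH[OF S])
      show "infinite (I - {k})" using insert.prems(2) by simp
      fix i assume "i \<in> I - {k}"
      then have i: "i \<in> I" "i \<noteq> k" by auto
      let ?d = "\<lambda>t. c i t \<oplus> r i \<otimes> c k t"
      have cl: "c i t \<odot>\<^bsub>M\<^esub> t \<in> carrier M" "c k t \<odot>\<^bsub>M\<^esub> t \<in> carrier M"
          "c i t \<in> carrier R" "c k t \<in> carrier R" "t \<in> carrier M" if "t \<in> S" for t
        using S cS[OF i(1)] cS[OF k(1)] that by auto
      have "(\<Oplus>\<^bsub>M\<^esub>t\<in>S. ?d t \<odot>\<^bsub>M\<^esub> t) = (\<Oplus>\<^bsub>M\<^esub>t\<in>S. c i t \<odot>\<^bsub>M\<^esub> t \<oplus>\<^bsub>M\<^esub> r i \<odot>\<^bsub>M\<^esub> (c k t \<odot>\<^bsub>M\<^esub> t))"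
        using cl r[OF i(1)] by (intro M.finsum_cong') (auto simp: smult_l_distr smult_assoc1)
      also have "\<dots> = (\<Oplus>\<^bsub>M\<^esub>t\<in>S. c i t \<odot>\<^bsub>M\<^esub> t) \<oplus>\<^bsub>M\<^esub> r i \<odot>\<^bsub>M\<^esub> (\<Oplus>\<^bsub>M\<^esub>t\<in>S. c k t \<odot>\<^bsub>M\<^esub> t)"
        using cl r[OF i(1)] insert.hyps
        by (subst M.finsum_addf) (auto simp: finsum_smult_ldistr)
      also have "\<dots> = w i"
      proof -
        let ?x = "c i s \<odot>\<^bsub>M\<^esub> s" and ?y = "\<Oplus>\<^bsub>M\<^esub>t\<in>S. c i t \<odot>\<^bsub>M\<^esub> t"
          and ?z = "r i \<odot>\<^bsub>M\<^esub> (\<Oplus>\<^bsub>M\<^esub>t\<in>S. c k t \<odot>\<^bsub>M\<^esub> t)"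
        have cl': "?x \<in> carrier M" "?y \<in> carrier M" "?z \<in> carrier M"
          using s cs[OF i(1)] fin[OF i(1)] fin[OF k(1)] r[OF i(1)] by auto
        have "r i \<odot>\<^bsub>M\<^esub> v k = (r i \<otimes> c k s) \<odot>\<^bsub>M\<^esub> s \<oplus>\<^bsub>M\<^esub> ?z"
          using split[OF k(1)] s cs[OF k(1)] fin[OF k(1)] r[OF i(1)]
          by (simp add: smult_r_distr smult_assoc1)
        also have "\<dots> = \<ominus>\<^bsub>M\<^esub> ?x \<oplus>\<^bsub>M\<^esub> ?z"
          using s cs[OF i(1)] by (simp add: rk[OF i(1)] smult_l_minus)
        finally have "w i = (?x \<oplus>\<^bsub>M\<^esub> ?y) \<oplus>\<^bsub>M\<^esub> (\<ominus>\<^bsub>M\<^esub> ?x \<oplus>\<^bsub>M\<^esub> ?z)"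
          by (simp only: w_def split[OF i(1)])
        also have "\<dots> = ?y \<oplus>\<^bsub>M\<^esub> ?z"
        proof -
          have "(?x \<oplus>\<^bsub>M\<^esub> ?y) \<oplus>\<^bsub>M\<^esub> (\<ominus>\<^bsub>M\<^esub> ?x \<oplus>\<^bsub>M\<^esub> ?z) = (?x \<oplus>\<^bsub>M\<^esub> \<ominus>\<^bsub>M\<^esub> ?x) \<oplus>\<^bsub>M\<^esub> (?y \<oplus>\<^bsub>M\<^esub> ?z)"
            using cl' by (simp only: M.a_ac M.add.inv_closed M.a_closed)
          then show ?thesis using cl' by (simp add: M.r_neg)
        qed
        finally show ?thesis by simp
      qed
      finally have "w i = (\<Oplus>\<^bsub>M\<^esub>t\<in>S. ?d t \<odot>\<^bsub>M\<^esub> t)" by simp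
      moreover have "?d \<in> S \<rightarrow> carrier R" using cl r[OF i(1)] by auto
      ultimately show "\<exists>c. c \<in> S \<rightarrow> carrier R \<and> w i = (\<Oplus>\<^bsub>M\<^esub>t\<in>S. c t \<odot>\<^bsub>M\<^esub> t)" by blast
    next
      fix i j assume "i \<in> I - {k}" "j \<in> I - {k}" "i \<noteq> j"
      then show "w j \<in> C i"
        unfolding w_def using insert.prems(3)[of i] insert.prems(5) k r[of j]
        by (intro submoduleE(4,5)) auto
    qed (use insert.prems in auto)
    then obtain i where i: "i \<in> I" "i \<noteq> k" "w i \<in> C i" by blast
    have "r i \<odot>\<^bsub>M\<^esub> v k \<in> C i"
      using insert.prems(3)[OF i(1)] insert.prems(5)[OF i(1) k(1) i(2)] r[OF i(1)]
      by (metis submoduleE(4))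
    then have "w i \<oplus>\<^bsub>M\<^esub> \<ominus>\<^bsub>M\<^esub> (r i \<odot>\<^bsub>M\<^esub> v k) \<in> C i"
      using insert.prems(3)[OF i(1)] i(3) by (intro submoduleE(3,5)) auto
    moreover have "w i \<oplus>\<^bsub>M\<^esub> \<ominus>\<^bsub>M\<^esub> (r i \<odot>\<^bsub>M\<^esub> v k) = v i"
      unfolding w_def using vM[OF i(1)] vM[OF k(1)] r[OF i(1)]
      by (simp add: M.a_assoc M.r_neg)
    ultimately show ?thesis using i(1) by auto
  qed
qed

lemma field_complex_ring: "field complex_ring"
proof (rule cring.cring_fieldI2)
  show "cring complex_ring"
    by (rule cringI[OF abelian_groupI comm_monoidI])
      (auto simp: complex_ring_def algebra_simps intro: exI[of _ "- _"] add.left_inverse)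
  show "\<zero>\<^bsub>complex_ring\<^esub> \<noteq> \<one>\<^bsub>complex_ring\<^esub>" by (simp add: complex_ring_def)
  show "\<exists>b\<in>carrier complex_ring. a \<otimes>\<^bsub>complex_ring\<^esub> b = \<one>\<^bsub>complex_ring\<^esub>"
    if "a \<in> carrier complex_ring" "a \<noteq> \<zero>\<^bsub>complex_ring\<^esub>" for a
    using that by (auto simp: complex_ring_def intro: exI[of _ "inverse a"])
qed

lemma (in cstar_algebra) commutant_submodule:
  assumes a: "a \<in> carrier A"
  shows "submodule {x \<in> carrier A. a \<otimes> x = x \<otimes> a} complex_ring A"
proof -
  have C: "c \<in> carrier complex_ring" for c by (simp add: complex_ring_def)
  have zero: "x = \<zero>" if "x \<in> carrier A" "x \<oplus> x = x" for x
    using that M.add.l_cancel_one' by auto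
  have smult: "c \<odot> x \<in> carrier A" if "x \<in> carrier A" for c x
    using C that by (rule smult_closed)
  have "\<ominus>\<^bsub>complex_ring\<^esub> \<one>\<^bsub>complex_ring\<^esub> = -1"
    using R.minus_equality[of "-1" "\<one>\<^bsub>complex_ring\<^esub>"] by (simp add: complex_ring_def)
  then have neg: "\<ominus> x = (-1) \<odot> x" if "x \<in> carrier A" for x
    using smult_l_minus[OF R.one_closed that] smult_one[OF that] by simp
  have "a \<otimes> \<zero> = \<zero>" "\<zero> \<otimes> a = \<zero>"
    using mult_add_right[of \<zero> \<zero> a] mult_add_left[of \<zero> \<zero> a] a
    by (auto intro!: zero mult_closed)
  then show ?thesis
    using a by (intro submoduleI)
      (auto simp: mult_add_left mult_add_right smult_mult_left smult_mult_right smult neg)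
qed

text \<open>The case of the preceding lemma in which the submodules are the commutants of the \<open>p i\<close>.\<close>

lemma (in cstar_algebra) finite_dimensional_commuting_pair:
  assumes fd: "finite_dimensional A" and I: "infinite I"
    and p: "\<And>i. i \<in> I \<Longrightarrow> p i \<in> carrier A" and q: "\<And>i. i \<in> I \<Longrightarrow> q i \<in> carrier A"
    and comm: "\<And>i j. i \<in> I \<Longrightarrow> j \<in> I \<Longrightarrow> i \<noteq> j \<Longrightarrow> p i \<otimes> q j = q j \<otimes> p i"
  shows "\<exists>i\<in>I. p i \<otimes> q i = q i \<otimes> p i"
proof -
  obtain S where S: "finite S" "S \<subseteq> carrier A"
    "\<And>x. x \<in> carrier A \<Longrightarrow> \<exists>c. x = (\<Oplus>s\<in>S. c s \<odot> s)"
    using fd unfolding finite_dimensional_def by metis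
  have "\<exists>i\<in>I. q i \<in> {x \<in> carrier A. p i \<otimes> x = x \<otimes> p i}"
    using p q comm S
    by (intro exists_member_of_own_submodule[OF field_complex_ring S(1,2) I] commutant_submodule)
      (auto simp: complex_ring_def)
  then show ?thesis by blast
qed

section \<open>A criterion for failure of residual finite dimensionality\<close>

definition distant_conjugates_commute :: "('a, 'm) monoid_scheme \<Rightarrow> 'a \<Rightarrow> 'a \<Rightarrow> 'a \<Rightarrow> bool" where
  "distant_conjugates_commute G c a b \<longleftrightarrow>
     (\<forall>n. a \<otimes>\<^bsub>G\<^esub> (c [^]\<^bsub>G\<^esub> Suc n \<otimes>\<^bsub>G\<^esub> b \<otimes>\<^bsub>G\<^esub> inv\<^bsub>G\<^esub> (c [^]\<^bsub>G\<^esub> Suc n)) =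
          (c [^]\<^bsub>G\<^esub> Suc n \<otimes>\<^bsub>G\<^esub> b \<otimes>\<^bsub>G\<^esub> inv\<^bsub>G\<^esub> (c [^]\<^bsub>G\<^esub> Suc n)) \<otimes>\<^bsub>G\<^esub> a)"

text \<open>The conjugates \<open>c\<^sup>i a c\<^sup>-\<^sup>i\<close> and \<open>c\<^sup>j b c\<^sup>-\<^sup>j\<close> commute for \<open>i \<noteq> j\<close>, so in a finite
  dimensional quotient they must commute for some \<open>i = j\<close>, and then \<open>a\<close> and \<open>b\<close> commute there,
  too. The element \<open>x = u(ab) - u(ba)\<close> is specified by \<open>u(ab) = x + u(ba)\<close>, an equation that a
  homomorphism carries over directly.\<close>

lemma not_residually_finite_dimensionalI:
  assumes G: "group G" and u: "u \<in> carrier G \<rightarrow> carrier R"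
    and u_mult: "\<And>g h. g \<in> carrier G \<Longrightarrow> h \<in> carrier G \<Longrightarrow> u (g \<otimes>\<^bsub>G\<^esub> h) = u g \<otimes>\<^bsub>R\<^esub> u h"
    and abc: "a \<in> carrier G" "b \<in> carrier G" "c \<in> carrier G"
    and comm: "distant_conjugates_commute G c a b" "distant_conjugates_commute G c b a"
    and x: "x \<in> carrier R" "x \<noteq> \<zero>\<^bsub>R\<^esub>" "u (a \<otimes>\<^bsub>G\<^esub> b) = x \<oplus>\<^bsub>R\<^esub> u (b \<otimes>\<^bsub>G\<^esub> a)"
  shows "\<not> residually_finite_dimensional R"
proof
  interpret G: group G by (rule G)
  define conj where "conj n g = c [^]\<^bsub>G\<^esub> n \<otimes>\<^bsub>G\<^esub> g \<otimes>\<^bsub>G\<^esub> inv\<^bsub>G\<^esub> (c [^]\<^bsub>G\<^esub> n)" for n :: nat and g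
  have conj: "conj n g \<in> carrier G" if "g \<in> carrier G" for n g
    using that abc(3) by (simp add: conj_def)
  have conj_mult: "conj n (g \<otimes>\<^bsub>G\<^esub> h) = conj n g \<otimes>\<^bsub>G\<^esub> conj n h"
    if "g \<in> carrier G" "h \<in> carrier G" for n g h
    using that abc(3) by (simp add: conj_def G.m_assoc G.inv_solve_left)
  have conj_add: "conj (m + n) g = conj m (conj n g)" if "g \<in> carrier G" for m n g
    using that abc(3) by (simp add: conj_def G.nat_pow_mult[symmetric] G.inv_mult_group G.m_assoc)
  have far: "conj i a \<otimes>\<^bsub>G\<^esub> conj j b = conj j b \<otimes>\<^bsub>G\<^esub> conj i a" if "i \<noteq> j" for i j
  proof (cases "i < j")
    case True
    then obtain n where j: "j = i + Suc n" using less_imp_Suc_add by auto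
    have "a \<otimes>\<^bsub>G\<^esub> conj (Suc n) b = conj (Suc n) b \<otimes>\<^bsub>G\<^esub> a"
      using comm(1) by (simp only: conj_def distant_conjugates_commute_def)
    then have "conj i (a \<otimes>\<^bsub>G\<^esub> conj (Suc n) b) = conj i (conj (Suc n) b \<otimes>\<^bsub>G\<^esub> a)" by simp
    then show ?thesis
      unfolding j using abc by (simp only: conj_mult conj conj_add)
  next
    case False
    then have "j < i" using that by simp
    then obtain n where i: "i = j + Suc n" using less_imp_Suc_add by auto
    have "b \<otimes>\<^bsub>G\<^esub> conj (Suc n) a = conj (Suc n) a \<otimes>\<^bsub>G\<^esub> b"
      using comm(2) by (simp only: conj_def distant_conjugates_commute_def)
    then have "conj j (b \<otimes>\<^bsub>G\<^esub> conj (Suc n) a) = conj j (conj (Suc n) a \<otimes>\<^bsub>G\<^esub> b)" by simp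
    then show ?thesis
      unfolding i using abc by (simp only: conj_mult conj conj_add)
  qed
  assume "residually_finite_dimensional R"
  then obtain B :: "(nat \<Rightarrow> complex) star_algebra" and \<pi>
    where B: "cstar_algebra B" "finite_dimensional B" and \<pi>: "\<pi> \<in> star_hom R B" "\<pi> x \<noteq> \<zero>\<^bsub>B\<^esub>"
    unfolding residually_finite_dimensional_def using x(1,2) by blast
  interpret B: cstar_algebra B by (rule B(1))
  define \<rho> where "\<rho> g = \<pi> (u g)" for g
  have \<rho>: "\<rho> g \<in> carrier B" if "g \<in> carrier G" for g
    using that u \<pi>(1) by (auto simp: \<rho>_def star_hom_def)
  have \<rho>_mult: "\<rho> (g \<otimes>\<^bsub>G\<^esub> h) = \<rho> g \<otimes>\<^bsub>B\<^esub> \<rho> h" if "g \<in> carrier G" "h \<in> carrier G" for g h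
    using that u \<pi>(1) by (simp add: \<rho>_def star_hom_def u_mult Pi_iff)
  have "\<exists>i\<in>UNIV. \<rho> (conj i a) \<otimes>\<^bsub>B\<^esub> \<rho> (conj i b) = \<rho> (conj i b) \<otimes>\<^bsub>B\<^esub> \<rho> (conj i a)"
    using abc by (intro B.finite_dimensional_commuting_pair[OF B(2)])
      (simp_all add: \<rho> conj far flip: \<rho>_mult)
  then obtain i where "\<rho> (conj i a) \<otimes>\<^bsub>B\<^esub> \<rho> (conj i b) = \<rho> (conj i b) \<otimes>\<^bsub>B\<^esub> \<rho> (conj i a)" by blast
  then have i: "\<rho> (conj i (a \<otimes>\<^bsub>G\<^esub> b)) = \<rho> (conj i (b \<otimes>\<^bsub>G\<^esub> a))"
    using abc by (simp add: conj_mult \<rho>_mult conj)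
  have unconj: "\<rho> g = \<rho> (inv\<^bsub>G\<^esub> (c [^]\<^bsub>G\<^esub> i)) \<otimes>\<^bsub>B\<^esub> \<rho> (conj i g) \<otimes>\<^bsub>B\<^esub> \<rho> (c [^]\<^bsub>G\<^esub> i)"
    if "g \<in> carrier G" for g
  proof -
    have "g = inv\<^bsub>G\<^esub> (c [^]\<^bsub>G\<^esub> i) \<otimes>\<^bsub>G\<^esub> conj i g \<otimes>\<^bsub>G\<^esub> c [^]\<^bsub>G\<^esub> i"
      using that abc(3) by (simp add: conj_def G.m_assoc G.inv_solve_left)
    then show ?thesis
      using that abc(3) conj by (metis \<rho>_mult G.inv_closed G.m_closed G.nat_pow_closed)
  qed
  have "\<rho> (a \<otimes>\<^bsub>G\<^esub> b) = \<rho> (b \<otimes>\<^bsub>G\<^esub> a)"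
    using unconj[of "a \<otimes>\<^bsub>G\<^esub> b"] unconj[of "b \<otimes>\<^bsub>G\<^esub> a"] i abc by simp
  moreover have "\<rho> (a \<otimes>\<^bsub>G\<^esub> b) = \<pi> x \<oplus>\<^bsub>B\<^esub> \<rho> (b \<otimes>\<^bsub>G\<^esub> a)"
    using \<pi>(1) x u abc by (auto simp: \<rho>_def star_hom_def)
  moreover have "\<pi> x \<in> carrier B" using \<pi>(1) x(1) by (auto simp: star_hom_def)
  ultimately have "\<pi> x = \<zero>\<^bsub>B\<^esub>"
    using \<rho>[of "b \<otimes>\<^bsub>G\<^esub> a"] abc B.M.add.r_cancel_one'[of "\<rho> (b \<otimes>\<^bsub>G\<^esub> a)" "\<pi> x"] by auto
  with \<pi>(2) show False by contradiction
qed

section \<open>Permutation operators\<close>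

definition permutation_op :: "('a \<Rightarrow> 'a) \<Rightarrow> ('a ell2 \<Rightarrow>\<^sub>L 'a ell2)" where
  "permutation_op s = Blinfun (\<lambda>\<psi>. Abs_ell2 (\<lambda>x. Rep_ell2 \<psi> (s x)))"

lemma Rep_ell2_reindex:
  assumes "bij s"
  shows "Rep_ell2 (Abs_ell2 (\<lambda>x. Rep_ell2 \<psi> (s x))) = (\<lambda>x. Rep_ell2 \<psi> (s x))"
proof (rule Abs_ell2_inverse)
  have "(\<lambda>x. (cmod (Rep_ell2 \<psi> x))\<^sup>2) summable_on UNIV"
    using Rep_ell2[of \<psi>] by simp
  then have "(\<lambda>x. (cmod (Rep_ell2 \<psi> (s x)))\<^sup>2) summable_on UNIV"
    using summable_on_reindex_bij_betw[OF assms, of "\<lambda>x. (cmod (Rep_ell2 \<psi> x))\<^sup>2"] by simp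
  then show "(\<lambda>x. Rep_ell2 \<psi> (s x)) \<in> {f. (\<lambda>x. (cmod (f x))\<^sup>2) summable_on UNIV}" by simp
qed

lemma bounded_linear_reindex:
  fixes s :: "'a \<Rightarrow> 'a"
  assumes "bij s"
  shows "bounded_linear (\<lambda>\<psi>. Abs_ell2 (\<lambda>x. Rep_ell2 \<psi> (s x)))"
proof (rule bounded_linear_intro[where K = 1])
  note R = Rep_ell2_reindex[OF assms]
  show "norm (Abs_ell2 (\<lambda>x. Rep_ell2 \<psi> (s x))) \<le> norm \<psi> * 1" for \<psi> :: "'a ell2"
    using infsum_reindex_bij_betw[OF assms, of "\<lambda>x. inner (Rep_ell2 \<psi> x) (Rep_ell2 \<psi> x)"]
    by (simp add: norm_eq_sqrt_inner inner_ell2.rep_eq R)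
next
  show "Abs_ell2 (\<lambda>x. Rep_ell2 (\<phi> + \<psi>) (s x)) =
      Abs_ell2 (\<lambda>x. Rep_ell2 \<phi> (s x)) + Abs_ell2 (\<lambda>x. Rep_ell2 \<psi> (s x))" for \<phi> \<psi> :: "'a ell2"
    using Rep_ell2_reindex[OF assms, of "\<phi> + \<psi>"]
    by (simp add: Rep_ell2_inject[symmetric] plus_ell2.rep_eq Rep_ell2_reindex[OF assms])
  show "Abs_ell2 (\<lambda>x. Rep_ell2 (r *\<^sub>R \<psi>) (s x)) = r *\<^sub>R Abs_ell2 (\<lambda>x. Rep_ell2 \<psi> (s x))"
    for r and \<psi> :: "'a ell2"
    using Rep_ell2_reindex[OF assms, of "r *\<^sub>R \<psi>"]
    by (simp add: Rep_ell2_inject[symmetric] scaleR_ell2.rep_eq Rep_ell2_reindex[OF assms])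
qed

lemma Rep_permutation_op:
  assumes "bij s"
  shows "Rep_ell2 (blinfun_apply (permutation_op s) \<psi>) x = Rep_ell2 \<psi> (s x)"
  by (simp add: permutation_op_def bounded_linear_Blinfun_apply bounded_linear_reindex[OF assms]
      Rep_ell2_reindex[OF assms])

lemma ell2_eqI: "(\<And>x. Rep_ell2 f x = Rep_ell2 g x) \<Longrightarrow> f = g"
  by (simp add: Rep_ell2_inject[symmetric] fun_eq_iff)

lemma permutation_op_compose:
  assumes "bij s" "bij t"
  shows "permutation_op (t \<circ> s) = permutation_op s o\<^sub>L permutation_op t"
  by (rule blinfun_eqI, rule ell2_eqI) (simp add: Rep_permutation_op assms bij_comp)

text \<open>The point mass at \<open>s x\<close> tells the two operators apart if \<open>s x \<noteq> t x\<close>.\<close>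

lemma permutation_op_inject:
  assumes s: "bij s" and t: "bij t" and eq: "permutation_op s = permutation_op t"
  shows "s = t"
proof
  fix x
  let ?f = "\<lambda>y. if y = s x then 1 else 0 :: complex"
  have "(\<lambda>y. (cmod (?f y))\<^sup>2) summable_on {s x}" by simp
  then have "(\<lambda>y. (cmod (?f y))\<^sup>2) summable_on UNIV"
    by (rule summable_on_cong_neutral[THEN iffD1, rotated -1]) auto
  then have R: "Rep_ell2 (Abs_ell2 ?f) = ?f" by (simp add: Abs_ell2_inverse)
  show "s x = t x"
    using Rep_permutation_op[OF s, of "Abs_ell2 ?f" x] Rep_permutation_op[OF t, of "Abs_ell2 ?f" x]
    by (auto simp: eq R split: if_splits)
qed

lemma unitary_permutation_op:
  assumes s: "bij s"
  shows "unitary_op (permutation_op s)"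
  unfolding unitary_op_def
proof (intro conjI allI)
  show "complex_linear (permutation_op s)"
    unfolding complex_linear_def
    by (intro allI ell2_eqI) (simp add: Rep_permutation_op s scaleC.rep_eq)
  have inv: "bij (inv_into UNIV s)" using s by (rule bij_imp_bij_inv)
  have "blinfun_apply (permutation_op s) (blinfun_apply (permutation_op (inv_into UNIV s)) \<psi>) = \<psi>" for \<psi>
    by (rule ell2_eqI) (simp add: Rep_permutation_op s inv bij_is_inj)
  then show "surj (blinfun_apply (permutation_op s))" by (rule surjI)
  show "cinner (blinfun_apply (permutation_op s) x) (blinfun_apply (permutation_op s) y) = cinner x y" for x y
    using infsum_reindex_bij_betw[OF s, of "\<lambda>h. cnj (Rep_ell2 x h) * Rep_ell2 y h"]
    by (simp add: cinner.rep_eq Rep_permutation_op s)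
qed

lemma scale_op_one: "scale_op 1 T = T"
proof -
  have "scaleC 1 f = f" for f :: "'a ell2" by (rule ell2_eqI) (simp add: scaleC.rep_eq)
  then show ?thesis by (simp add: scale_op_def blinfun_apply_inverse)
qed

lemma scale_op_minus_one: "scale_op (-1) T = - T"
proof -
  have "scaleC (-1) f = - f" for f :: "'a ell2"
    by (rule ell2_eqI) (simp add: scaleC.rep_eq uminus_ell2.rep_eq)
  then have "scale_op (-1) T = Blinfun (\<lambda>f. - blinfun_apply T f)"
    by (simp add: scale_op_def)
  also have "(\<lambda>f. - blinfun_apply T f) = blinfun_apply (- T)"
    by (simp add: fun_eq_iff blinfun.minus_left)
  finally show ?thesis by (simp add: blinfun_apply_inverse)
qed

section \<open>Group C*-algebras\<close>

locale group_on_type = group G for G :: "'g monoid" +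
  assumes carrier_UNIV [simp]: "carrier G = UNIV"
begin

lemma bij_left_mult: "bij (\<lambda>h. inv\<^bsub>G\<^esub> g \<otimes>\<^bsub>G\<^esub> h)"
proof (rule bij_betw_byWitness[where f' = "\<lambda>h. g \<otimes>\<^bsub>G\<^esub> h"])
qed (simp_all add: m_assoc[symmetric])

lemma left_translation_eq: "left_translation G g = permutation_op (\<lambda>h. inv\<^bsub>G\<^esub> g \<otimes>\<^bsub>G\<^esub> h)"
  by (simp add: left_translation_def permutation_op_def)

lemma left_translation_mult:
  "left_translation G (g \<otimes>\<^bsub>G\<^esub> h) = left_translation G g o\<^sub>L left_translation G h"
  unfolding left_translation_eq permutation_op_compose[OF bij_left_mult bij_left_mult, symmetric]
  by (rule arg_cong[of _ _ permutation_op]) (simp add: fun_eq_iff inv_mult_group m_assoc)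

lemma left_translation_inject:
  assumes "left_translation G g = left_translation G h"
  shows "g = h"
proof -
  have "(\<lambda>k. inv\<^bsub>G\<^esub> g \<otimes>\<^bsub>G\<^esub> k) = (\<lambda>k. inv\<^bsub>G\<^esub> h \<otimes>\<^bsub>G\<^esub> k)"
    using assms unfolding left_translation_eq by (intro permutation_op_inject bij_left_mult)
  then have "inv\<^bsub>G\<^esub> g \<otimes>\<^bsub>G\<^esub> \<one>\<^bsub>G\<^esub> = inv\<^bsub>G\<^esub> h \<otimes>\<^bsub>G\<^esub> \<one>\<^bsub>G\<^esub>" by (rule fun_cong)
  then show ?thesis by (metis UNIV_I carrier_UNIV inv_closed inv_inv r_one)
qed

text \<open>The left regular representation with countably infinite multiplicity, which makes it act on
  the space used for the universal representation.\<close>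

definition amplified_translation :: "'g representation" where
  "amplified_translation g = permutation_op (map_prod (\<lambda>h. inv\<^bsub>G\<^esub> g \<otimes>\<^bsub>G\<^esub> h) id)"

lemma bij_amplified: "bij (map_prod (\<lambda>h. inv\<^bsub>G\<^esub> g \<otimes>\<^bsub>G\<^esub> h) (id :: nat \<Rightarrow> nat))"
  using bij_betw_map_prod[OF bij_left_mult bij_id] by (simp add: bij_betw_def)

lemma amplified_translation_in_unitary_reps: "amplified_translation \<in> unitary_reps G"
proof -
  have "amplified_translation (g \<otimes>\<^bsub>G\<^esub> h) = amplified_translation g o\<^sub>L amplified_translation h" for g h
    unfolding amplified_translation_def permutation_op_compose[OF bij_amplified bij_amplified, symmetric]
    by (rule arg_cong[of _ _ permutation_op]) (simp add: fun_eq_iff inv_mult_group m_assoc)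
  then show ?thesis
    by (simp add: unitary_reps_def amplified_translation_def unitary_permutation_op bij_amplified)
qed

lemma amplified_translation_inject:
  assumes "amplified_translation g = amplified_translation h"
  shows "g = h"
proof -
  have "map_prod (\<lambda>k. inv\<^bsub>G\<^esub> g \<otimes>\<^bsub>G\<^esub> k) (id :: nat \<Rightarrow> nat) = map_prod (\<lambda>k. inv\<^bsub>G\<^esub> h \<otimes>\<^bsub>G\<^esub> k) id"
    using assms unfolding amplified_translation_def by (intro permutation_op_inject bij_amplified)
  then have "map_prod (\<lambda>k. inv\<^bsub>G\<^esub> g \<otimes>\<^bsub>G\<^esub> k) (id :: nat \<Rightarrow> nat) (\<one>\<^bsub>G\<^esub>, 0) = map_prod (\<lambda>k. inv\<^bsub>G\<^esub> h \<otimes>\<^bsub>G\<^esub> k) id (\<one>\<^bsub>G\<^esub>, 0)" by (rule fun_cong)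
  then have "inv\<^bsub>G\<^esub> g = inv\<^bsub>G\<^esub> h" by simp
  then show ?thesis by (metis UNIV_I carrier_UNIV inv_inv)
qed

lemma sum_pair_signs:
  assumes "g \<noteq> h"
  shows "(\<Sum>k\<in>{g, h}. scale_op (if k = g then 1 else -1) (U k)) = U g - U h"
  using assms by (simp add: scale_op_one scale_op_minus_one)

text \<open>The element witnessing the failure is \<open>u(ab) - u(ba)\<close> in both cases; the sign function gives
  the coefficients of this combination of group elements.\<close>

lemma group_cstar_not_residually_finite_dimensional:
  assumes comm: "distant_conjugates_commute G c a b" "distant_conjugates_commute G c b a"
    and ab: "a \<otimes>\<^bsub>G\<^esub> b \<noteq> b \<otimes>\<^bsub>G\<^esub> a"
  shows "\<not> residually_finite_dimensional (reduced_group_cstar G)"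
    and "\<not> residually_finite_dimensional (full_group_cstar G)"
proof -
  let ?ab = "a \<otimes>\<^bsub>G\<^esub> b" and ?ba = "b \<otimes>\<^bsub>G\<^esub> a"
  let ?sgn = "\<lambda>k. if k = ?ab then 1 else - 1 :: complex"
  show "\<not> residually_finite_dimensional (reduced_group_cstar G)"
  proof (rule not_residually_finite_dimensionalI
      [OF is_group, where u = "left_translation G" and a = a and b = b and c = c, OF _ _ _ _ _ comm])
    have "left_translation G g \<in> op_span (left_translation G)" for g
      unfolding op_span_def
      by (rule CollectI, rule exI[of _ "{g}"], rule exI[of _ "\<lambda>_. 1"]) (simp add: scale_op_one)
    then show "left_translation G \<in> carrier G \<rightarrow> carrier (reduced_group_cstar G)"
      using closure_subset by (auto simp: reduced_group_cstar_def)
    have "left_translation G ?ab - left_translation G ?ba \<in> op_span (left_translation G)"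
      unfolding op_span_def
      by (rule CollectI, rule exI[of _ "{?ab, ?ba}"], rule exI[of _ ?sgn])
        (simp only: sum_pair_signs[OF ab], simp)
    then show "left_translation G ?ab - left_translation G ?ba \<in> carrier (reduced_group_cstar G)"
      using closure_subset by (auto simp: reduced_group_cstar_def)
    show "left_translation G ?ab - left_translation G ?ba \<noteq> \<zero>\<^bsub>reduced_group_cstar G\<^esub>"
      using left_translation_inject ab by (auto simp: reduced_group_cstar_def)
  qed (simp_all add: reduced_group_cstar_def left_translation_mult)
  let ?u = "\<lambda>g \<pi>. if \<pi> \<in> unitary_reps G then \<pi> g else 0"
  have span: "f \<in> carrier (full_group_cstar G)" if "f \<in> universal_span G" for f
  proof -
    have "f \<pi> = 0" if "\<pi> \<notin> unitary_reps G" for \<pi>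
      using \<open>f \<in> universal_span G\<close> that by (auto simp: universal_span_def)
    then show ?thesis
      using that by (auto simp: full_group_cstar_def uniform_limit_iff intro!: exI[of _ "\<lambda>_. f"])
  qed
  show "\<not> residually_finite_dimensional (full_group_cstar G)"
  proof (rule not_residually_finite_dimensionalI
      [OF is_group, where u = ?u and a = a and b = b and c = c, OF _ _ _ _ _ comm])
    have "?u g \<in> universal_span G" for g
      unfolding universal_span_def
      by (rule CollectI, rule exI[of _ "{g}"], rule exI[of _ "\<lambda>_. 1"]) (auto simp: scale_op_one)
    then show "?u \<in> carrier G \<rightarrow> carrier (full_group_cstar G)"
      using span by blast
    let ?x = "\<lambda>\<pi>. if \<pi> \<in> unitary_reps G then \<pi> ?ab - \<pi> ?ba else 0"
    have "?x \<in> universal_span G"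
      unfolding universal_span_def
      by (rule CollectI, rule exI[of _ "{?ab, ?ba}"], rule exI[of _ ?sgn])
        (simp only: sum_pair_signs[OF ab], simp)
    then show "?x \<in> carrier (full_group_cstar G)" by (rule span)
    have "?x amplified_translation \<noteq> 0"
      using amplified_translation_in_unitary_reps amplified_translation_inject ab by auto
    then show "?x \<noteq> \<zero>\<^bsub>full_group_cstar G\<^esub>"
      by (auto simp: full_group_cstar_def dest: fun_cong[of _ _ amplified_translation])
  qed (auto simp: full_group_cstar_def unitary_reps_def)
qed

end

section \<open>Piecewise affine maps with dyadic pieces\<close>

lemma dyadic_rationals_of_int [simp]: "of_int m \<in> dyadic_rationals"
  unfolding dyadic_rationals_def by (intro CollectI exI[of _ m] exI[of _ 0]) simp

lemma dyadic_rationals_0_1 [simp]: "0 \<in> dyadic_rationals" "1 \<in> dyadic_rationals"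
  using dyadic_rationals_of_int[of 0] dyadic_rationals_of_int[of 1] by simp_all

lemma dyadic_rationals_powi [simp]: "2 powi k \<in> dyadic_rationals"
proof (cases "0 \<le> k")
  case True
  then show ?thesis
    using dyadic_rationals_of_int[of "2 ^ nat k"] by (simp add: power_int_def)
next
  case False
  then show ?thesis
    unfolding dyadic_rationals_def
    by (intro CollectI exI[of _ 1] exI[of _ "nat (- k)"]) (simp add: power_int_def inverse_eq_divide power_divide)
qed

lemma dyadic_rationals_add [simp]:
  assumes "x \<in> dyadic_rationals" "y \<in> dyadic_rationals"
  shows "x + y \<in> dyadic_rationals"
proof -
  obtain m n m' n' where xy: "x = of_int m / 2 ^ n" "y = of_int m' / 2 ^ n'"
    using assms unfolding dyadic_rationals_def by auto
  have "x + y = of_int (m * 2 ^ n' + m' * 2 ^ n) / 2 ^ (n + n')"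
    unfolding xy by (simp add: field_simps power_add)
  then show ?thesis unfolding dyadic_rationals_def by blast
qed

lemma dyadic_rationals_mult [simp]:
  assumes "x \<in> dyadic_rationals" "y \<in> dyadic_rationals"
  shows "x * y \<in> dyadic_rationals"
proof -
  obtain m n m' n' where "x = of_int m / 2 ^ n" "y = of_int m' / 2 ^ n'"
    using assms unfolding dyadic_rationals_def by auto
  then have "x * y = of_int (m * m') / 2 ^ (n + n')"
    by (simp add: power_add)
  then show ?thesis unfolding dyadic_rationals_def by blast
qed

lemma dyadic_rationals_minus [simp]: "x \<in> dyadic_rationals \<Longrightarrow> - x \<in> dyadic_rationals"
  using dyadic_rationals_mult[of "-1" x] dyadic_rationals_of_int[of "-1"] by simp

lemma dyadic_rationals_diff [simp]:
  "x \<in> dyadic_rationals \<Longrightarrow> y \<in> dyadic_rationals \<Longrightarrow> x - y \<in> dyadic_rationals"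
  using dyadic_rationals_add[of x "- y"] by simp

text \<open>The subdivision is hidden in the derivation, so that facts about all subdivisions become
  inductions.\<close>

inductive dyadic_pl :: "(real \<Rightarrow> real) \<Rightarrow> real \<Rightarrow> real \<Rightarrow> bool" for f where
  affine: "\<lbrakk>a < b; a \<in> dyadic_rationals; b \<in> dyadic_rationals; q \<in> dyadic_rationals;
      \<And>x. a \<le> x \<Longrightarrow> x \<le> b \<Longrightarrow> f x = 2 powi k * x + q\<rbrakk> \<Longrightarrow> dyadic_pl f a b"
| join: "\<lbrakk>dyadic_pl f a b; dyadic_pl f b c\<rbrakk> \<Longrightarrow> dyadic_pl f a c"

lemma dyadic_pl_less: "dyadic_pl f a b \<Longrightarrow> a < b"
  by (induction rule: dyadic_pl.induct) auto

lemma dyadic_pl_endpoints: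
  "dyadic_pl f a b \<Longrightarrow> a \<in> dyadic_rationals \<and> b \<in> dyadic_rationals \<and> f b \<in> dyadic_rationals"
  by (induction rule: dyadic_pl.induct) auto

lemma dyadic_pl_cong:
  "dyadic_pl f a b \<Longrightarrow> (\<And>x. a \<le> x \<Longrightarrow> x \<le> b \<Longrightarrow> g x = f x) \<Longrightarrow> dyadic_pl g a b"
proof (induction rule: dyadic_pl.induct)
  case (affine a b q k)
  then show ?case by (intro dyadic_pl.affine[of a b q g k]) auto
next
  case (join a b c)
  have "dyadic_pl g a b" "dyadic_pl g b c"
    using join.prems dyadic_pl_less[OF join.hyps(1)] dyadic_pl_less[OF join.hyps(2)]
    by (auto intro!: join.IH)
  then show ?case by (rule dyadic_pl.join)
qed

lemma dyadic_pl_strict_mono: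
  "dyadic_pl f a b \<Longrightarrow> a \<le> x \<Longrightarrow> x < y \<Longrightarrow> y \<le> b \<Longrightarrow> f x < f y"
proof (induction arbitrary: x y rule: dyadic_pl.induct)
  case (affine a b q k)
  then show ?case by auto
next
  case (join a b c)
  consider "y \<le> b" | "b \<le> x" | "x < b" "b < y" by linarith
  then show ?case
  proof cases
    case 3
    then have "f x < f b" "f b < f y" using join by auto
    then show ?thesis by simp
  qed (use join in auto)
qed

lemma dyadic_pl_continuous: "dyadic_pl f a b \<Longrightarrow> continuous_on {a..b} f"
proof (induction rule: dyadic_pl.induct)
  case (affine a b q k)
  have "continuous_on {a..b} (\<lambda>x. 2 powi k * x + q)" by (intro continuous_intros)
  then show ?case using affine(5) by (metis (no_types, lifting) atLeastAtMost_iff continuous_on_cong)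
next
  case (join a b c)
  then have "continuous_on ({a..b} \<union> {b..c}) f" by (intro continuous_on_closed_Un) auto
  then show ?case
    using dyadic_pl_less[OF join.hyps(1)] dyadic_pl_less[OF join.hyps(2)]
    by (simp add: ivl_disj_un_two_touch)
qed

lemma dyadic_pl_image:
  assumes "dyadic_pl f a b"
  shows "f ` {a..b} = {f a..f b}"
proof (intro equalityI subsetI)
  fix y assume "y \<in> f ` {a..b}"
  then obtain x where x: "a \<le> x" "x \<le> b" "y = f x" by auto
  then show "y \<in> {f a..f b}"
    using dyadic_pl_strict_mono[OF assms, of a x] dyadic_pl_strict_mono[OF assms, of x b]
    by (cases "a = x"; cases "x = b") auto
next
  fix y assume "y \<in> {f a..f b}"
  then show "y \<in> f ` {a..b}"
    using IVT'[of f a y b] dyadic_pl_continuous[OF assms] dyadic_pl_less[OF assms] by auto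
qed

text \<open>Any dyadic point may be added to the subdivision. This lets the subdivision for the outer
  map of a composition be refined to match the pieces of the inner map.\<close>

lemma dyadic_pl_split:
  "dyadic_pl f a c \<Longrightarrow> b \<in> dyadic_rationals \<Longrightarrow> a < b \<Longrightarrow> b < c \<Longrightarrow> dyadic_pl f a b \<and> dyadic_pl f b c"
proof (induction rule: dyadic_pl.induct)
  case (affine a c q k)
  then show ?case
    using dyadic_pl.affine[of a b q f k] dyadic_pl.affine[of b c q f k] by auto
next
  case (join a m c)
  consider "b < m" | "b = m" | "m < b" by linarith
  then show ?case
    using join by cases (auto intro: dyadic_pl.join)
qed

text \<open>Breakpoints are pulled back along \<open>x \<mapsto> 2\<^sup>k x + q\<close>; they stay dyadic as the inverse of this
  map has the same form.\<close>

lemma dyadic_pl_compose_affine: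
  "dyadic_pl g c d \<Longrightarrow> q \<in> dyadic_rationals \<Longrightarrow>
     dyadic_pl (\<lambda>x. g (2 powi k * x + q)) (2 powi (- k) * (c - q)) (2 powi (- k) * (d - q))"
proof (induction rule: dyadic_pl.induct)
  case (affine c d p l)
  have cancel: "2 powi k * (2 powi (- k) * y) = y" for y :: real
    by (simp add: power_int_minus)
  have le: "c \<le> 2 powi k * x + q \<longleftrightarrow> 2 powi (- k) * (c - q) \<le> x"
      "2 powi k * x + q \<le> d \<longleftrightarrow> x \<le> 2 powi (- k) * (d - q)" for x :: real
    by (simp_all add: power_int_minus field_simps)
  show ?case
  proof (rule dyadic_pl.affine[where k = "l + k" and q = "2 powi l * q + p"])
    fix x assume "2 powi (- k) * (c - q) \<le> x" "x \<le> 2 powi (- k) * (d - q)"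
    then have "g (2 powi k * x + q) = 2 powi l * (2 powi k * x + q) + p"
      by (intro affine.hyps(5)) (simp_all only: le)
    then show "g (2 powi k * x + q) = 2 powi (l + k) * x + (2 powi l * q + p)"
      by (simp add: power_int_add algebra_simps)
  qed (use affine in auto)
next
  case (join c m d)
  show ?case by (rule dyadic_pl.join[OF join.IH(1,2)[OF join.prems]])
qed

lemma dyadic_pl_compose:
  "dyadic_pl f a b \<Longrightarrow> dyadic_pl g (f a) (f b) \<Longrightarrow> dyadic_pl (\<lambda>x. g (f x)) a b"
proof (induction rule: dyadic_pl.induct)
  case (affine a b q k)
  have "2 powi (- k) * (f x - q) = x" if "a \<le> x" "x \<le> b" for x
    using affine.hyps(5)[OF that] by (simp add: power_int_minus)
  then have "dyadic_pl (\<lambda>x. g (2 powi k * x + q)) a b"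
    using dyadic_pl_compose_affine[OF affine.prems affine.hyps(4), of k] affine.hyps(1) by simp
  then show ?case by (rule dyadic_pl_cong) (simp add: affine.hyps(5))
next
  case (join a b c)
  have "f a < f b" "f b < f c"
    using dyadic_pl_strict_mono[OF join.hyps(1)] dyadic_pl_strict_mono[OF join.hyps(2)]
      dyadic_pl_less[OF join.hyps(1)] dyadic_pl_less[OF join.hyps(2)] by auto
  then have "dyadic_pl g (f a) (f b) \<and> dyadic_pl g (f b) (f c)"
    using dyadic_pl_split[OF join.prems] dyadic_pl_endpoints[OF join.hyps(1)] by simp
  then show ?case using join.IH by (auto intro: dyadic_pl.join)
qed

lemma dyadic_pl_inverse:
  "dyadic_pl f a b \<Longrightarrow> (\<And>x. a \<le> x \<Longrightarrow> x \<le> b \<Longrightarrow> g (f x) = x) \<Longrightarrow> dyadic_pl g (f a) (f b)"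
proof (induction rule: dyadic_pl.induct)
  case (affine a b q k)
  have eqs: "f a = 2 powi k * a + q" "f b = 2 powi k * b + q"
    by (rule affine.hyps(5); use affine.hyps(1) in simp)+
  show ?case
  proof (rule dyadic_pl.affine[where k = "- k" and q = "- (2 powi (- k) * q)"])
    fix y assume y: "f a \<le> y" "y \<le> f b"
    define x where "x = 2 powi (- k) * y + - (2 powi (- k) * q)"
    have cancel: "2 powi k * (2 powi (- k) * z) = z" for z :: real
      by (simp add: power_int_minus)
    have "2 powi k * x = y - q"
      unfolding x_def distrib_left mult_minus_right cancel by simp
    then have yx: "y = 2 powi k * x + q" by linarith
    have "2 powi k * a \<le> 2 powi k * x" "2 powi k * x \<le> 2 powi k * b" using y eqs yx by linarith+
    then have x: "a \<le> x" "x \<le> b" by simp_all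
    have "g y = g (f x)" by (simp only: affine.hyps(5)[OF x] yx[symmetric])
    also have "\<dots> = x" by (rule affine.prems[OF x])
    finally have "g y = x" .
    then show "g y = 2 powi (- k) * y + - (2 powi (- k) * q)" by (simp only: x_def)
  next
    have "2 powi k * a < 2 powi k * b" using affine.hyps(1) by simp
    then show "f a < f b" unfolding eqs by linarith
    show "f a \<in> dyadic_rationals" "f b \<in> dyadic_rationals" "- (2 powi (- k) * q) \<in> dyadic_rationals"
      unfolding eqs using affine.hyps(2-4) by simp_all
  qed
next
  case (join a b c)
  have "dyadic_pl g (f a) (f b)"
    by (rule join.IH(1), rule join.prems) (use dyadic_pl_less[OF join.hyps(2)] in simp_all)
  moreover have "dyadic_pl g (f b) (f c)"
    by (rule join.IH(2), rule join.prems) (use dyadic_pl_less[OF join.hyps(1)] in simp_all)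
  ultimately show ?case by (rule dyadic_pl.join)
qed

lemma affine_derivative_within:
  assumes "a < b" "x \<in> {a..b}" and f: "\<And>y. y \<in> {a..b} \<Longrightarrow> f y = m * y + c"
  shows "(f has_real_derivative m) (at x within {a..b})"
proof (rule has_field_derivative_transform_within[OF _ zero_less_one assms(2)])
  show "((\<lambda>y. m * y + c) has_real_derivative m) (at x within {a..b})"
    by (auto intro!: derivative_eq_intros)
qed (simp add: f)

lemma affine_derivative_within_unique:
  assumes "a < b" "x \<in> {a..b}" "\<And>y. y \<in> {a..b} \<Longrightarrow> f y = m * y + c"
    and "(f has_real_derivative d) (at x within {a..b})"
  shows "d = m"
proof -
  have "at x within {a..b} \<noteq> bot"
    using assms(1,2) by (simp add: trivial_limit_within islimpt_Icc)
  then show ?thesis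
    using assms(4) affine_derivative_within[OF assms(1-3)]
    unfolding has_field_derivative_iff by (rule tendsto_unique)
qed

text \<open>Restricted to either piece of a subdivision that contains \<open>x\<close>, even as an endpoint, the
  function has the same derivative \<open>d\<close>.\<close>

lemma dyadic_pl_derivative:
  "dyadic_pl f a b \<Longrightarrow> x \<in> {a..b} \<Longrightarrow> (f has_real_derivative d) (at x within {a..b}) \<Longrightarrow>
     \<exists>k::int. d = 2 powi k"
proof (induction rule: dyadic_pl.induct)
  case (affine a b q k)
  have "d = 2 powi k"
    by (rule affine_derivative_within_unique[OF affine.hyps(1) affine.prems(1) _ affine.prems(2), where c = q])
      (simp add: affine.hyps(5))
  then show ?case by (rule exI)
next
  case (join a b c)
  have sub: "{a..b} \<subseteq> {a..c}" "{b..c} \<subseteq> {a..c}"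
    using dyadic_pl_less[OF join.hyps(1)] dyadic_pl_less[OF join.hyps(2)] by auto
  show ?case
  proof (cases "x \<le> b")
    case True
    then show ?thesis
      using join.prems(1) by (intro join.IH(1)[OF _ has_field_derivative_subset[OF join.prems(2) sub(1)]]) simp
  next
    case False
    then show ?thesis
      using join.prems(1) by (intro join.IH(2)[OF _ has_field_derivative_subset[OF join.prems(2) sub(2)]]) simp
  qed
qed

lemma dyadic_pl_breakpoints:
  "dyadic_pl f a b \<Longrightarrow> \<exists>P. finite P \<and> P \<subseteq> dyadic_rationals \<and>
     (\<forall>a' b'. a \<le> a' \<and> a' < b' \<and> b' \<le> b \<and> {a'<..<b'} \<inter> P = {} \<longrightarrow>
        (\<exists>m c. \<forall>x\<in>{a'..b'}. f x = m * x + c)) \<and>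
     (\<forall>x\<in>{a..b} - P. f differentiable (at x within {a..b}))"
proof (induction rule: dyadic_pl.induct)
  case (affine a b q k)
  have "\<exists>m c. \<forall>x\<in>{a'..b'}. f x = m * x + c" if "a \<le> a'" "b' \<le> b" for a' b'
    using affine.hyps(5) that by (intro exI[of _ "2 powi k"] exI[of _ q]) auto
  moreover have "f differentiable (at x within {a..b})" if "x \<in> {a..b}" for x
    using affine_derivative_within[OF affine.hyps(1) that, of f "2 powi k" q] affine.hyps(5)
    by (auto simp: real_differentiable_def)
  ultimately show ?case by (intro exI[of _ "{}"]) simp
next
  case (join a b c)
  obtain P1 where P1: "finite P1" "P1 \<subseteq> dyadic_rationals"
    and lin1: "\<forall>a' b'. a \<le> a' \<and> a' < b' \<and> b' \<le> b \<and> {a'<..<b'} \<inter> P1 = {} \<longrightarrow>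
        (\<exists>m c. \<forall>x\<in>{a'..b'}. f x = m * x + c)"
    and diff1: "\<forall>x\<in>{a..b} - P1. f differentiable (at x within {a..b})"
    using join.IH(1) by blast
  obtain P2 where P2: "finite P2" "P2 \<subseteq> dyadic_rationals"
    and lin2: "\<forall>a' b'. b \<le> a' \<and> a' < b' \<and> b' \<le> c \<and> {a'<..<b'} \<inter> P2 = {} \<longrightarrow>
        (\<exists>m c. \<forall>x\<in>{a'..b'}. f x = m * x + c)"
    and diff2: "\<forall>x\<in>{b..c} - P2. f differentiable (at x within {b..c})"
    using join.IH(2) by blast
  have less: "a < b" "b < c"
    using dyadic_pl_less[OF join.hyps(1)] dyadic_pl_less[OF join.hyps(2)] .
  let ?P = "insert b (P1 \<union> P2)"
  have "\<exists>m d. \<forall>x\<in>{a'..b'}. f x = m * x + d"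
    if "a \<le> a'" "a' < b'" "b' \<le> c" "{a'<..<b'} \<inter> ?P = {}" for a' b'
  proof -
    have "b \<notin> {a'<..<b'}" using that(4) by blast
    then consider "b' \<le> b" | "b \<le> a'" using that(2) by force
    then show ?thesis
    proof cases
      case 1
      then show ?thesis using that by (intro lin1[rule_format]) auto
    next
      case 2
      then show ?thesis using that by (intro lin2[rule_format]) auto
    qed
  qed
  moreover have "f differentiable (at x within {a..c})" if "x \<in> {a..c} - ?P" for x
  proof (cases "x < b")
    case True
    have "at x within {a..c} = at x within {a..b}"
      by (rule at_within_nhd[of x "{..<b}"]) (use True less in auto)
    then show ?thesis using diff1 that True by auto
  next
    case False
    then have "b < x" using that by auto
    have "at x within {a..c} = at x within {b..c}"
      by (rule at_within_nhd[of x "{b<..}"]) (use \<open>b < x\<close> less in auto)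
    then show ?thesis using diff2 that \<open>b < x\<close> by auto
  qed
  moreover have "finite ?P" "?P \<subseteq> dyadic_rationals"
    using P1 P2 dyadic_pl_endpoints[OF join.hyps(1)] by auto
  ultimately show ?case by (intro exI[of _ ?P] conjI allI impI ballI) (assumption | elim conjE)+
qed

section \<open>Thompson's group as a group of dyadic maps\<close>

lemma card_less_card_split_at:
  fixes p :: real
  assumes "finite D" "p \<in> D" "a < p" "p < b"
  shows "card ({a<..<p} \<inter> D) < card ({a<..<b} \<inter> D)"
    and "card ({p<..<b} \<inter> D) < card ({a<..<b} \<inter> D)"
proof -
  have "p \<in> {a<..<b} \<inter> D" using assms by simp
  moreover have "{a<..<p} \<inter> D \<subseteq> {a<..<b} \<inter> D - {p}" "{p<..<b} \<inter> D \<subseteq> {a<..<b} \<inter> D - {p}"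
    using assms by auto
  ultimately show "card ({a<..<p} \<inter> D) < card ({a<..<b} \<inter> D)"
    "card ({p<..<b} \<inter> D) < card ({a<..<b} \<inter> D)"
    using assms(1) by (meson card_Diff1_less card_mono finite_Diff finite_Int le_less_trans)+
qed

text \<open>The points that separate linear pieces are a priori unrelated to the dyadic points of
  nondifferentiability. But if \<open>f\<close> is differentiable at a point between two linear pieces, their
  slopes agree and the pieces fit together; so the dyadic points suffice to separate the pieces.\<close>

lemma thompson_map_affine_between_breakpoints:
  assumes f: "thompson_map f"
  shows "\<exists>D. finite D \<and> D \<subseteq> dyadic_rationals \<and>
    (\<forall>a b. 0 \<le> a \<longrightarrow> a < b \<longrightarrow> b \<le> 1 \<longrightarrow> {a<..<b} \<inter> D = {} \<longrightarrow>
       (\<exists>(k::int) c. \<forall>x\<in>{a..b}. f x = 2 powi k * x + c))"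
proof -
  have "piecewise_linear_on_unit f" using f by (simp add: thompson_map_def)
  then obtain P where P: "finite P"
    and lin: "\<forall>a b. 0 \<le> a \<and> a < b \<and> b \<le> 1 \<and> {a<..<b} \<inter> P = {} \<longrightarrow>
      (\<exists>m c. \<forall>x\<in>{a..b}. f x = m * x + c)"
    unfolding piecewise_linear_on_unit_def by (elim exE conjE)
  have "\<exists>D. finite D \<and> D \<subseteq> dyadic_rationals \<and>
      (\<forall>x\<in>{0..1} - D. f differentiable (at x within {0..1}))"
    using f by (simp add: thompson_map_def)
  then obtain D where D: "finite D" "D \<subseteq> dyadic_rationals"
    "\<forall>x\<in>{0..1} - D. f differentiable (at x within {0..1})"
    by (elim exE conjE)
  have pow: "\<exists>k::int. d = 2 powi k" if "x \<in> {0..1}" "(f has_real_derivative d) (at x within {0..1})" for x d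
    using f that unfolding thompson_map_def by blast
  have affine: "\<exists>m c. \<forall>x\<in>{a..b}. f x = m * x + c"
    if "0 \<le> a" "a < b" "b \<le> 1" "{a<..<b} \<inter> D = {}" for a b
    using that
  proof (induction "card ({a<..<b} \<inter> P)" arbitrary: a b rule: less_induct)
    case less
    show ?case
    proof (cases "{a<..<b} \<inter> P = {}")
      case True
      then show ?thesis using less.prems by (intro lin[rule_format]) auto
    next
      case False
      then obtain p where p: "p \<in> P" "a < p" "p < b" by auto
      have "\<exists>m c. \<forall>z\<in>{a..p}. f z = m * z + c"
        by (rule less.hyps[OF card_less_card_split_at(1)[OF P p]]) (use less.prems p in \<open>auto simp: disjoint_iff\<close>)
      then obtain m1 c1 where 1: "\<And>z. z \<in> {a..p} \<Longrightarrow> f z = m1 * z + c1" by blast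
      have "\<exists>m c. \<forall>z\<in>{p..b}. f z = m * z + c"
        by (rule less.hyps[OF card_less_card_split_at(2)[OF P p]]) (use less.prems p in \<open>auto simp: disjoint_iff\<close>)
      then obtain m2 c2 where 2: "\<And>z. z \<in> {p..b} \<Longrightarrow> f z = m2 * z + c2" by blast
      have "p \<in> {0..1} - D" using less.prems p by auto
      with D(3) have "f differentiable (at p within {0..1})" by (rule bspec)
      then obtain d where d: "(f has_real_derivative d) (at p within {0..1})"
        unfolding real_differentiable_def by (elim exE)
      have "d = m1"
        by (rule affine_derivative_within_unique[of a p p f m1 c1])
          (use less.prems p 1 in \<open>auto intro: has_field_derivative_subset[OF d]\<close>)
      moreover have "d = m2"
        by (rule affine_derivative_within_unique[of p b p f m2 c2])
          (use less.prems p 2 in \<open>auto intro: has_field_derivative_subset[OF d]\<close>)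
      moreover have "m1 * p + c1 = m2 * p + c2"
        using 1[of p] 2[of p] p by simp
      ultimately have "f x = m1 * x + c1" if "x \<in> {a..b}" for x
        using that 1[of x] 2[of x] by (cases "x \<le> p") auto
      then show ?thesis by (intro exI ballI)
    qed
  qed
  show ?thesis
  proof (intro exI[of _ D] conjI allI impI D(1,2))
    fix a b :: real assume ab: "0 \<le> a" "a < b" "b \<le> 1" "{a<..<b} \<inter> D = {}"
    then have "\<exists>m c. \<forall>x\<in>{a..b}. f x = m * x + c" by (rule affine)
    then obtain m c where mc: "\<And>x. x \<in> {a..b} \<Longrightarrow> f x = m * x + c" by blast
    let ?x = "(a + b) / 2"
    have x: "?x \<in> {a..b}" "?x \<in> {0..1}" "?x \<in> {a<..<b}" using ab by auto
    then have "?x \<in> {0..1} - D" using ab(4) by blast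
    with D(3) have "f differentiable (at ?x within {0..1})" by (rule bspec)
    then obtain d where d: "(f has_real_derivative d) (at ?x within {0..1})"
      unfolding real_differentiable_def by (elim exE)
    have "d = m"
      by (rule affine_derivative_within_unique[OF ab(2) x(1) mc])
        (use ab in \<open>auto intro: has_field_derivative_subset[OF d]\<close>)
    then obtain k :: int where "m = 2 powi k" using pow[OF x(2) d] by auto
    then show "\<exists>(k::int) c. \<forall>x\<in>{a..b}. f x = 2 powi k * x + c"
      using mc by (intro exI[of _ k] exI[of _ c] ballI) simp
  qed
qed

text \<open>For the direction from left to right, all slopes are positive, so \<open>f\<close> increases and fixes
  the endpoints. Starting from \<open>f 0 = 0\<close>, dyadic values propagate from each breakpoint to the
  next, because slopes are powers of two and breakpoints are dyadic; hence the intercepts are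
  dyadic.\<close>

lemma thompson_map_iff:
  "thompson_map f \<longleftrightarrow> f \<in> extensional {0..1} \<and> f 0 = 0 \<and> f 1 = 1 \<and> dyadic_pl f 0 1"
proof (intro iffI conjI)
  assume f: "thompson_map f"
  then show "f \<in> extensional {0..1}" by (simp add: thompson_map_def)
  obtain D where D: "finite D" "D \<subseteq> dyadic_rationals"
    and affine: "\<forall>a b. 0 \<le> a \<longrightarrow> a < b \<longrightarrow> b \<le> 1 \<longrightarrow> {a<..<b} \<inter> D = {} \<longrightarrow>
       (\<exists>(k::int) c. \<forall>x\<in>{a..b}. f x = 2 powi k * x + c)"
    using thompson_map_affine_between_breakpoints[OF f] by (elim exE conjE)
  have im: "f ` {0..1} = {0..1}"
    using f unfolding thompson_map_def by (auto dest: homeomorphism_image1)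
  have mono: "f a < f b" if "0 \<le> a" "a < b" "b \<le> 1" for a b
    using that
  proof (induction "card ({a<..<b} \<inter> D)" arbitrary: a b rule: less_induct)
    case less
    show ?case
    proof (cases "{a<..<b} \<inter> D = {}")
      case True
      obtain k :: int and c where "\<forall>x\<in>{a..b}. f x = 2 powi k * x + c"
        using affine[rule_format, OF less.prems True] by (elim exE)
      then show ?thesis using less.prems by simp
    next
      case False
      then obtain p where p: "p \<in> D" "a < p" "p < b" by auto
      have "card ({a<..<p} \<inter> D) < card ({a<..<b} \<inter> D)" "card ({p<..<b} \<inter> D) < card ({a<..<b} \<inter> D)"
        using card_less_card_split_at[OF D(1) p] by auto
      then have "f a < f p" "f p < f b"
        by (intro less.hyps; use less.prems p in simp)+
      then show ?thesis by simp
    qed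
  qed
  have "f x \<in> {0..1}" if "x \<in> {0..1}" for x using im that by blast
  note range = this[of 0] this[of 1]
  obtain x where x: "x \<in> {0..1}" "f x = 0" using im by (metis atLeastAtMost_iff image_iff order_refl zero_le_one)
  obtain y where y: "y \<in> {0..1}" "f y = 1" using im by (metis atLeastAtMost_iff image_iff order_refl zero_le_one)
  show f0: "f 0 = 0"
  proof (rule ccontr)
    assume "f 0 \<noteq> 0"
    then have "0 < x" using x by (cases "x = 0") auto
    then have "f 0 < 0" using mono[of 0 x] x by simp
    then show False using range by simp
  qed
  show "f 1 = 1"
  proof (rule ccontr)
    assume "f 1 \<noteq> 1"
    then have "y < 1" using y by (cases "y = 1") auto
    then have "1 < f 1" using mono[of y 1] y by simp
    then show False using range by simp
  qed
  have "dyadic_pl f a b"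
    if "0 \<le> a" "a < b" "b \<le> 1" "a \<in> dyadic_rationals" "b \<in> dyadic_rationals" "f a \<in> dyadic_rationals" for a b
    using that
  proof (induction "card ({a<..<b} \<inter> D)" arbitrary: a b rule: less_induct)
    case less
    show ?case
    proof (cases "{a<..<b} \<inter> D = {}")
      case True
      obtain k :: int and c where k: "\<forall>x\<in>{a..b}. f x = 2 powi k * x + c"
        using affine[rule_format, OF less.prems(1-3) True] by (elim exE)
      then have "c = f a - 2 powi k * a" using less.prems by simp
      then have "c \<in> dyadic_rationals" using less.prems by simp
      then show ?thesis using less.prems k by (intro dyadic_pl.affine[of a b c f k]) auto
    next
      case False
      then obtain p where p: "p \<in> D" "a < p" "p < b" by auto
      have card: "card ({a<..<p} \<inter> D) < card ({a<..<b} \<inter> D)" "card ({p<..<b} \<inter> D) < card ({a<..<b} \<inter> D)"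
        using card_less_card_split_at[OF D(1) p] by auto
      have ap: "dyadic_pl f a p"
        by (rule less.hyps[OF card(1)]) (use less.prems p D(2) in auto)
      then have "f p \<in> dyadic_rationals" using dyadic_pl_endpoints by blast
      then have "dyadic_pl f p b"
        by (intro less.hyps[OF card(2)]) (use less.prems p D(2) in auto)
      with ap show ?thesis by (rule dyadic_pl.join)
    qed
  qed
  then show "dyadic_pl f 0 1" using f0 by simp
next
  assume "f \<in> extensional {0..1} \<and> f 0 = 0 \<and> f 1 = 1 \<and> dyadic_pl f 0 1"
  then have f: "f \<in> extensional {0..1}" "f 0 = 0" "f 1 = 1" "dyadic_pl f 0 1" by auto
  obtain P where P: "finite P" "P \<subseteq> dyadic_rationals"
      "\<forall>a b. 0 \<le> a \<and> a < b \<and> b \<le> 1 \<and> {a<..<b} \<inter> P = {} \<longrightarrow> (\<exists>m c. \<forall>x\<in>{a..b}. f x = m * x + c)"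
      "\<forall>x\<in>{0..1} - P. f differentiable (at x within {0..1})"
    using dyadic_pl_breakpoints[OF f(4)] by (elim exE conjE)
  have "inj_on f {0..1}"
    by (rule linorder_inj_onI') (use dyadic_pl_strict_mono[OF f(4)] in force)
  then have "\<exists>g. homeomorphism {0..1} {0..1} f g"
    using dyadic_pl_continuous[OF f(4)] dyadic_pl_image[OF f(4)] f(2,3)
    by (intro homeomorphism_compact) auto
  then show "thompson_map f"
    unfolding thompson_map_def piecewise_linear_on_unit_def
    using f(1) P dyadic_pl_derivative[OF f(4)] by (intro conjI exI[of _ P] ballI allI impI) auto
qed

lemma thompson_map_bij_betw:
  assumes "thompson_map f"
  shows "bij_betw f {0..1} {0..1}"
proof -
  obtain g where "homeomorphism {0..1} {0..1} f g"
    using assms unfolding thompson_map_def by blast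
  then show ?thesis
    by (intro bij_betw_byWitness[where f' = g]) (auto simp: homeomorphism_def)
qed

lemma thompson_map_compose:
  assumes f: "thompson_map f" and g: "thompson_map g"
  shows "thompson_map (compose {0..1} g f)"
proof -
  have "dyadic_pl (\<lambda>x. g (f x)) 0 1"
    by (rule dyadic_pl_compose) (use f g in \<open>simp_all add: thompson_map_iff\<close>)
  then have "dyadic_pl (compose {0..1} g f) 0 1"
    by (rule dyadic_pl_cong) (simp add: compose_def)
  then show ?thesis
    using f g by (simp add: thompson_map_iff compose_def)
qed

lemma thompson_map_inverse:
  assumes f: "thompson_map f"
  shows "thompson_map (\<lambda>x\<in>{0..1}. inv_into {0..1} f x)"
proof -
  have inv: "inv_into {0..1} f (f x) = x" if "x \<in> {0..1}" for x
    using thompson_map_bij_betw[OF f] that by (simp add: bij_betw_inv_into_left)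
  have f01: "f 0 = 0" "f 1 = 1" "dyadic_pl f 0 1" using f by (simp_all add: thompson_map_iff)
  have "dyadic_pl (inv_into {0..1} f) (f 0) (f 1)"
    using f01(3) by (rule dyadic_pl_inverse) (simp add: inv)
  then have "dyadic_pl (inv_into {0..1} f) 0 1" by (simp only: f01)
  then have "dyadic_pl (\<lambda>x\<in>{0..1}. inv_into {0..1} f x) 0 1"
    by (rule dyadic_pl_cong) simp
  moreover have "inv_into {0..1} f 0 = 0" "inv_into {0..1} f 1 = 1"
    using inv[of 0] inv[of 1] f01 by auto
  ultimately show ?thesis by (simp add: thompson_map_iff)
qed

lemma thompson_map_Rep_thompson: "thompson_map (Rep_thompson g)"
  using Rep_thompson[of g] by simp

lemma Rep_thompson_in_unit: "x \<in> {0..1} \<Longrightarrow> Rep_thompson g x \<in> {0..1}"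
  using thompson_map_bij_betw[OF thompson_map_Rep_thompson] by (rule bij_betwE[THEN bspec])

lemma Rep_thompson_strict_mono: "0 \<le> x \<Longrightarrow> x < y \<Longrightarrow> y \<le> 1 \<Longrightarrow> Rep_thompson g x < Rep_thompson g y"
  using thompson_map_Rep_thompson[of g] dyadic_pl_strict_mono[of "Rep_thompson g" 0 1 x y]
  by (simp add: thompson_map_iff)

lemma thompson_eqI:
  assumes "\<And>x. x \<in> {0..1} \<Longrightarrow> Rep_thompson g x = Rep_thompson h x"
  shows "g = h"
proof -
  have "Rep_thompson g = Rep_thompson h"
  proof (rule extensionalityI)
    show "Rep_thompson g \<in> extensional {0..1}" "Rep_thompson h \<in> extensional {0..1}"
      using thompson_map_Rep_thompson[of g] thompson_map_Rep_thompson[of h] by (simp_all add: thompson_map_iff)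
  qed (rule assms)
  then show ?thesis by (simp add: Rep_thompson_inject)
qed

lemma Rep_thompson_mult:
  assumes "x \<in> {0..1}"
  shows "Rep_thompson (g \<otimes>\<^bsub>thompson_group\<^esub> h) x = Rep_thompson g (Rep_thompson h x)"
  using assms thompson_map_compose[OF thompson_map_Rep_thompson[of h] thompson_map_Rep_thompson[of g]]
  by (simp add: thompson_group_def Abs_thompson_inverse compose_eq)

lemma Rep_thompson_one:
  assumes "x \<in> {0..1}"
  shows "Rep_thompson \<one>\<^bsub>thompson_group\<^esub> x = x"
  using assms thompson_map_id by (simp add: thompson_group_def Abs_thompson_inverse)

lemma carrier_thompson_group [simp]: "carrier thompson_group = UNIV"
  by (simp add: thompson_group_def)

lemma group_thompson_group: "group thompson_group"
proof (rule groupI)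
  fix g h k :: thompson
  show "g \<otimes>\<^bsub>thompson_group\<^esub> h \<otimes>\<^bsub>thompson_group\<^esub> k = g \<otimes>\<^bsub>thompson_group\<^esub> (h \<otimes>\<^bsub>thompson_group\<^esub> k)"
    by (rule thompson_eqI) (simp only: Rep_thompson_mult Rep_thompson_in_unit)
  show "\<one>\<^bsub>thompson_group\<^esub> \<otimes>\<^bsub>thompson_group\<^esub> g = g"
    by (rule thompson_eqI) (simp only: Rep_thompson_mult Rep_thompson_one Rep_thompson_in_unit)
  let ?h = "\<lambda>x\<in>{0..1}. inv_into {0..1} (Rep_thompson g) x"
  have "Abs_thompson ?h \<otimes>\<^bsub>thompson_group\<^esub> g = \<one>\<^bsub>thompson_group\<^esub>"
  proof (rule thompson_eqI)
    fix x :: real assume x: "x \<in> {0..1}"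
    have "Rep_thompson (Abs_thompson ?h) = ?h"
      using thompson_map_inverse[OF thompson_map_Rep_thompson[of g]] by (simp only: Abs_thompson_inverse mem_Collect_eq)
    then show "Rep_thompson (Abs_thompson ?h \<otimes>\<^bsub>thompson_group\<^esub> g) x = Rep_thompson \<one>\<^bsub>thompson_group\<^esub> x"
      using x Rep_thompson_in_unit[OF x, of g] bij_betw_inv_into_left[OF thompson_map_bij_betw[OF thompson_map_Rep_thompson] x]
      by (simp only: Rep_thompson_mult Rep_thompson_one restrict_apply if_True)
  qed
  then show "\<exists>h\<in>carrier thompson_group. h \<otimes>\<^bsub>thompson_group\<^esub> g = \<one>\<^bsub>thompson_group\<^esub>" by auto
qed simp_all

interpretation thompson: group_on_type thompson_group
  by (rule group_on_type.intro[OF group_thompson_group]) (unfold_locales, simp)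

section \<open>Elements with disjoint supports\<close>

text \<open>A copy of the standard generator \<open>x\<^sub>0\<close> of Thompson's group on \<open>[r, r + s]\<close>, with slopes
  \<open>1/2\<close>, \<open>1\<close>, \<open>2\<close> on pieces of lengths \<open>s/2\<close>, \<open>s/4\<close>, \<open>s/4\<close>. It moves points to the left.\<close>

definition bump :: "real \<Rightarrow> real \<Rightarrow> thompson" where
  "bump r s = Abs_thompson (\<lambda>x\<in>{0..1}.
     if x \<le> r \<or> r + s \<le> x then x
     else if x \<le> r + s / 2 then (x + r) / 2
     else if x \<le> r + 3 * s / 4 then x - s / 4
     else 2 * x - (r + s))"

lemma Rep_bump:
  assumes r: "r \<in> dyadic_rationals" "0 < r" and s: "s \<in> dyadic_rationals" "0 < s" "r + s < 1"
    and x: "x \<in> {0..1}"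
  shows "Rep_thompson (bump r s) x =
     (if x \<le> r \<or> r + s \<le> x then x
      else if x \<le> r + s / 2 then (x + r) / 2
      else if x \<le> r + 3 * s / 4 then x - s / 4
      else 2 * x - (r + s))"
proof -
  let ?f = "\<lambda>x\<in>{0..1}. if x \<le> r \<or> r + s \<le> x then x
     else if x \<le> r + s / 2 then (x + r) / 2
     else if x \<le> r + 3 * s / 4 then x - s / 4
     else 2 * x - (r + s)"
  have half: "t / 2 \<in> dyadic_rationals" if "t \<in> dyadic_rationals" for t
    using dyadic_rationals_mult[OF that dyadic_rationals_powi[of "-1"]] by simp
  have dy: "s / 2 \<in> dyadic_rationals" "s / 4 \<in> dyadic_rationals" "3 * s / 4 \<in> dyadic_rationals"
      "r / 2 \<in> dyadic_rationals"
  proof -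
    show s2: "s / 2 \<in> dyadic_rationals" "r / 2 \<in> dyadic_rationals" using half r s by auto
    show s4: "s / 4 \<in> dyadic_rationals" using half[OF s2(1)] by simp
    have "3 * s / 4 = s / 2 + s / 4" by simp
    then show "3 * s / 4 \<in> dyadic_rationals" using s2 s4 by (metis dyadic_rationals_add)
  qed
  have 1: "dyadic_pl ?f 0 r"
    by (rule dyadic_pl.affine[where k = 0 and q = 0]) (use r s in auto)
  have 2: "dyadic_pl ?f r (r + s / 2)"
    by (rule dyadic_pl.affine[where k = "-1" and q = "r / 2"]) (use r s dy in auto)
  have 3: "dyadic_pl ?f (r + s / 2) (r + 3 * s / 4)"
    by (rule dyadic_pl.affine[where k = 0 and q = "- (s / 4)"]) (use r s dy in auto)
  have 4: "dyadic_pl ?f (r + 3 * s / 4) (r + s)"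
    by (rule dyadic_pl.affine[where k = 1 and q = "- (r + s)"]) (use r s dy in auto)
  have 5: "dyadic_pl ?f (r + s) 1"
    by (rule dyadic_pl.affine[where k = 0 and q = 0]) (use r s in auto)
  have "dyadic_pl ?f 0 1"
    by (rule dyadic_pl.join[OF dyadic_pl.join[OF dyadic_pl.join[OF dyadic_pl.join[OF 1 2] 3] 4] 5])
  moreover have "?f 0 = 0" "?f 1 = 1" using r s by auto
  ultimately have "thompson_map ?f" by (simp only: thompson_map_iff restrict_extensional simp_thms)
  then have "Rep_thompson (bump r s) = ?f" by (simp only: bump_def Abs_thompson_inverse mem_Collect_eq)
  then show ?thesis using x by (simp only: restrict_apply if_True)
qed

text \<open>Both \<open>[0, t]\<close> and \<open>[t, 1]\<close> are invariant under \<open>g\<close> and \<open>h\<close>, since elements of the group are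
  increasing and both fix \<open>t\<close>; on either interval one of them is the identity.\<close>

lemma disjoint_supports_commute:
  assumes t: "t \<in> {0..1}"
    and g: "\<And>x. x \<in> {0..1} \<Longrightarrow> x \<le> t \<Longrightarrow> Rep_thompson g x = x"
    and h: "\<And>x. x \<in> {0..1} \<Longrightarrow> t \<le> x \<Longrightarrow> Rep_thompson h x = x"
  shows "g \<otimes>\<^bsub>thompson_group\<^esub> h = h \<otimes>\<^bsub>thompson_group\<^esub> g"
proof (rule thompson_eqI)
  fix x :: real assume x: "x \<in> {0..1}"
  show "Rep_thompson (g \<otimes>\<^bsub>thompson_group\<^esub> h) x = Rep_thompson (h \<otimes>\<^bsub>thompson_group\<^esub> g) x"
  proof (cases "x \<le> t")
    case True
    have "Rep_thompson h x \<le> t"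
      using True x t Rep_thompson_strict_mono[of x t h] h[of t] by (cases "x = t") auto
    then show ?thesis
      using g[OF x True] g[OF Rep_thompson_in_unit[OF x, of h]] by (simp only: Rep_thompson_mult[OF x])
  next
    case False
    have "t \<le> Rep_thompson g x"
      using False x t Rep_thompson_strict_mono[of t x g] g[of t] by auto
    then show ?thesis
      using h[OF x] False h[OF Rep_thompson_in_unit[OF x, of g]] by (simp add: Rep_thompson_mult[OF x])
  qed
qed

text \<open>A positive power \<open>d\<close> of \<open>c\<close> still maps \<open>t'\<close> below \<open>t\<close>, so that the conjugate \<open>d h d\<^sup>-\<^sup>1\<close> is
  supported in \<open>[0, t]\<close>, where \<open>g\<close> is the identity.\<close>

lemma distant_conjugates_commute_supports:
  assumes t: "t \<in> {0..1}" "t' \<in> {0..1}"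
    and c: "\<And>x. x \<in> {0..1} \<Longrightarrow> Rep_thompson c x \<le> x" "Rep_thompson c t' \<le> t"
    and g: "\<And>x. x \<in> {0..1} \<Longrightarrow> x \<le> t \<Longrightarrow> Rep_thompson g x = x"
    and h: "\<And>x. x \<in> {0..1} \<Longrightarrow> t' \<le> x \<Longrightarrow> Rep_thompson h x = x"
  shows "distant_conjugates_commute thompson_group c g h"
  unfolding distant_conjugates_commute_def
proof
  fix n
  let ?d = "c [^]\<^bsub>thompson_group\<^esub> Suc n"
  let ?h' = "?d \<otimes>\<^bsub>thompson_group\<^esub> h \<otimes>\<^bsub>thompson_group\<^esub> inv\<^bsub>thompson_group\<^esub> ?d"
  have pow: "Rep_thompson (c [^]\<^bsub>thompson_group\<^esub> m) x \<le> x" if "x \<in> {0..1}" for m :: nat and x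
    using that
  proof (induction m arbitrary: x)
    case 0
    then show ?case by (simp only: nat_pow_0 Rep_thompson_one order_refl)
  next
    case (Suc m)
    have "Rep_thompson (c [^]\<^bsub>thompson_group\<^esub> Suc m) x = Rep_thompson (c [^]\<^bsub>thompson_group\<^esub> m) (Rep_thompson c x)"
      by (simp only: nat_pow_Suc Rep_thompson_mult[OF Suc.prems])
    also have "\<dots> \<le> Rep_thompson c x" by (rule Suc.IH[OF Rep_thompson_in_unit[OF Suc.prems]])
    also have "\<dots> \<le> x" by (rule c(1)[OF Suc.prems])
    finally show ?case .
  qed
  have d: "Rep_thompson ?d t' \<le> t"
  proof -
    have "Rep_thompson ?d t' = Rep_thompson (c [^]\<^bsub>thompson_group\<^esub> n) (Rep_thompson c t')"
      by (simp only: nat_pow_Suc Rep_thompson_mult[OF t(2)])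
    also have "\<dots> \<le> Rep_thompson c t'" by (rule pow[OF Rep_thompson_in_unit[OF t(2)]])
    finally show ?thesis using c(2) by linarith
  qed
  show "g \<otimes>\<^bsub>thompson_group\<^esub> ?h' = ?h' \<otimes>\<^bsub>thompson_group\<^esub> g"
  proof (rule disjoint_supports_commute[OF t(1)])
    show "Rep_thompson g x = x" if "x \<in> {0..1}" "x \<le> t" for x using that by (rule g)
  next
    fix x :: real assume x: "x \<in> {0..1}" "t \<le> x"
    define y where "y = Rep_thompson (inv\<^bsub>thompson_group\<^esub> ?d) x"
    have y: "y \<in> {0..1}" unfolding y_def by (rule Rep_thompson_in_unit[OF x(1)])
    have dy: "Rep_thompson ?d y = x"
    proof -
      have "Rep_thompson ?d y = Rep_thompson (?d \<otimes>\<^bsub>thompson_group\<^esub> inv\<^bsub>thompson_group\<^esub> ?d) x"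
        unfolding y_def by (rule Rep_thompson_mult[OF x(1), symmetric])
      also have "?d \<otimes>\<^bsub>thompson_group\<^esub> inv\<^bsub>thompson_group\<^esub> ?d = \<one>\<^bsub>thompson_group\<^esub>"
        by (rule thompson.r_inv) (simp only: carrier_thompson_group UNIV_I)
      finally show ?thesis by (simp only: Rep_thompson_one[OF x(1)])
    qed
    have "t' \<le> y"
    proof (rule ccontr)
      assume "\<not> t' \<le> y"
      then have "Rep_thompson ?d y < Rep_thompson ?d t'"
        using y t by (intro Rep_thompson_strict_mono) auto
      then show False using d dy x(2) by linarith
    qed
    have "Rep_thompson ?h' x = Rep_thompson ?d (Rep_thompson h y)"
      by (simp only: Rep_thompson_mult[OF x(1)] Rep_thompson_mult[OF y] y_def[symmetric])
    also have "\<dots> = x" by (simp only: h[OF y \<open>t' \<le> y\<close>] dy)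
    finally show "Rep_thompson ?h' x = x" .
  qed
qed

theorem theorem4p7:
  shows "\<not> residually_finite_dimensional (reduced_group_cstar thompson_group) \<and>
         \<not> residually_finite_dimensional (full_group_cstar thompson_group)"
proof -
  define a b c where "a = bump (1 / 2) (1 / 8)" and "b = bump (1 / 2) (1 / 16)" and "c = bump (1 / 4) (1 / 2)"
  have inv_pow: "1 / 2 ^ n \<in> dyadic_rationals" for n
    unfolding dyadic_rationals_def by (intro CollectI exI[of _ 1] exI[of _ n]) simp
  have dy: "1 / 2 \<in> dyadic_rationals" "1 / 4 \<in> dyadic_rationals" "1 / 8 \<in> dyadic_rationals" "1 / 16 \<in> dyadic_rationals"
    using inv_pow[of 1] inv_pow[of 2] inv_pow[of 3] inv_pow[of 4] by simp_all
  \<comment> \<open>The fundamental domain \<open>[1/2, 5/8]\<close> of \<open>c\<close>, bounded by the ends of its middle piece, contains the supports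
    of \<open>a\<close> and \<open>b\<close>, as \<open>c\<close> maps \<open>5/8\<close> to \<open>1/2\<close>.\<close>
  note a = Rep_bump[OF dy(1) _ dy(3), folded a_def, simplified]
    and b = Rep_bump[OF dy(1) _ dy(4), folded b_def, simplified]
    and c = Rep_bump[OF dy(2) _ dy(1), folded c_def, simplified]
  have "distant_conjugates_commute thompson_group c a b" "distant_conjugates_commute thompson_group c b a"
    by (rule distant_conjugates_commute_supports[of "1 / 2" "5 / 8"]; simp add: a b c)+
  moreover have "a \<otimes>\<^bsub>thompson_group\<^esub> b \<noteq> b \<otimes>\<^bsub>thompson_group\<^esub> a"
  proof
    \<comment> \<open>The point \<open>37/64\<close> is fixed by \<open>b\<close>, but \<open>a\<close> moves it to \<open>35/64\<close>, which \<open>b\<close> moves.\<close>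
    assume "a \<otimes>\<^bsub>thompson_group\<^esub> b = b \<otimes>\<^bsub>thompson_group\<^esub> a"
    then have "Rep_thompson a (Rep_thompson b (37 / 64)) = Rep_thompson b (Rep_thompson a (37 / 64))"
      by (simp flip: Rep_thompson_mult)
    then show False by (simp add: a b)
  qed
  ultimately show ?thesis
    using thompson.group_cstar_not_residually_finite_dimensional by blast
qed

end
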